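(* Let $m\ge 1$ be fixed and let $(X_N)_{N\ge1}$ be a sequence of $\mathbf{R}^m$-valued random variables defined on a probability space $(\Omega,\Sigma,\mathbf{P})$, such that $(X_N)$ converges in the mod-Gaussian sense with covariance $(Q_N)$ and limiting function $\Phi$, and such that the convergence is $\mu$-balanced with $\mu>0$, with $\sigma_N\ge 1$ for all $N$. Let $(G_N)$ be (centered) Gaussian random vectors with covariance matrices given by $(Q_N)$, so that $\mathbf{E}(e^{it\cdot G_N})=\exp(-Q_N(t)/2)$. Assume moreover the following three conditions: (1) There exist constants $a>0$, $\alpha>0$ and $C>0$ such that, for any $N\ge1$ and $t\in\mathbf{R}^m$ with $\|t\|\le\sigma_N^a$, we have $$\mathbf{E}(e^{it\cdot X_N})=\Phi(t)\exp(-Q_N(t)/2)\Bigl\{1+O\Bigl(\frac{1}{\exp(\alpha\sigma_N^C)}\Bigr)\Bigr\}.$$ (2) The function $\Phi$ is of class $C^1$ on $\{\|t\|<2\}$. (3) For some $A\ge1$ and $\beta\ge0$, we have $|\Phi(t)|\ll\exp(\beta\|t\|^A)$ for $t\in\mathbf{R}^m$. Let $D>0$ be any number such that $$D>2\bigl(m+1+\max\{a^{-1},\,A/C,\,3m(m+1)\mu A\}\bigr).$$ Then, for any fixed non-empty open box $U=\{x\in\mathbf{R}^m\mid\|x-x_0\|_\infty<\varepsilon\}\subset\mathbf{R}^m$ with $0<\varepsilon\le1$, we have $$\mathbf{P}(X_N\in U)=\mathbf{P}(G_N\in U)+O\Bigl(\frac{1}{\sigma_N^{1/2+1/D}}+\frac{\varepsilon^{-m}}{\sigma_N}\Bigr)$$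 for $N\ge1$, where the implied constant depends only on $(m,\Phi,a,\alpha,C)$ and the implied constant in (1). In particular, for any fixed non-empty open set $U\subset\mathbf{R}^m$, we have $$\mathbf{P}(X_N\in U)\gg\frac{1}{\sqrt{\sigma_N}}$$ provided $N\ge N_0$, where $N_0$ and the implied constant depend on $U$, on $(m,\Phi,a,\alpha,C)$ and on the implied constant in (1).
   Context: Mod-Gaussian convergence: given non-negative quadratic forms $Q_N$ on $\mathbf{R}^m$, the sequence $(X_N)$ converges in the mod-Gaussian sense with covariance $(Q_N)$ and limiting function $\Phi:\mathbf{R}^m\to\mathbf{C}$ if $\lim_{N\to+\infty}\exp(Q_N(t)/2)\,\mathbf{E}(e^{it\cdot X_N})=\Phi(t)$ locally uniformly for $t\in\mathbf{R}^m$, where $\cdot$ is the standard inner product; then $\Phi$ is continuous at $0$ and $\Phi(0)=1$. Let $0\le\delta_{1,N}\le\dots\le\delta_{m,N}$ be the eigenvalues of $Q_N$ when diagonalized in an orthonormal basis for the standard inner product. The convergence is $\mu$-balanced if $\delta_{m,N}\le\delta_{1,N}^{\mu}$ for all $N$ and $\delta_{m,N}\to+\infty$ as $N\to+\infty$. Set $\sigma_N=\delta_{1,N}\cdots\delta_{m,N}$. Here $\|\cdot\|$ is the Euclidean norm and $\|\cdot\|_\infty$ the sup norm on $\mathbf{R}^m$. $f\ll g$ and $f=O(g)$ mean $|f|\le \mathrm{const}\cdot g$ on the indicated range, the constant being "the implied constant"; in (1) it is uniform in $N$ and $t$.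
   Formalization: N_0 may also depend on the covariance sequence (Q_N), since a threshold depending only on the listed data fails (sigma_N=1 for arbitrarily many N); constants are stated for a given underlying set of each probability space, and passing to laws removes this. *)

theory Defs
  imports "HOL-Probability.Probability"
begin

definition nonneg_quadratic_form :: "(real^'m \<Rightarrow> real) \<Rightarrow> bool" where
  "nonneg_quadratic_form q \<longleftrightarrow>
     (\<exists>B. bilinear B \<and> (\<forall>t. q t = B t t)) \<and> (\<forall>t. 0 \<le> q t)"

text \<open>
  The eigenvalues of a quadratic form with respect to the standard inner product, with
  multiplicity and in increasing order: in suitable orthonormal coordinates the form is
  \<open>d\<^sub>1 x\<^sub>1\<^sup>2 + \<dots> + d\<^sub>m x\<^sub>m\<^sup>2\<close>. As \<open>m\<close> orthonormal vectors of \<open>real^'m\<close> form a basis, this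
  determines the list \<open>ds\<close>, and the spectral theorem says that it exists for every
  quadratic form.
\<close>

definition eigenvalue_list :: "(real^'m \<Rightarrow> real) \<Rightarrow> real list \<Rightarrow> bool" where
  "eigenvalue_list q ds \<longleftrightarrow>
     length ds = CARD('m) \<and> sorted ds \<and>
     (\<exists>v :: nat \<Rightarrow> real^'m.
        (\<forall>i<CARD('m). \<forall>j<CARD('m). v i \<bullet> v j = (if i = j then 1 else 0)) \<and>
        (\<forall>t. q t = (\<Sum>i<CARD('m). ds ! i * (v i \<bullet> t)\<^sup>2)))"

definition char_vec :: "'a measure \<Rightarrow> ('a \<Rightarrow> real^'m) \<Rightarrow> real^'m \<Rightarrow> complex" where
  "char_vec M X t = (CLINT \<omega>|M. iexp (t \<bullet> X \<omega>))"

text \<open>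
  Sequences are indexed by \<open>N \<ge> 1\<close>; values at \<open>N = 0\<close> are irrelevant throughout.
\<close>

definition mod_gaussian ::
  "'a measure \<Rightarrow> (nat \<Rightarrow> 'a \<Rightarrow> real^'m) \<Rightarrow> (nat \<Rightarrow> real^'m \<Rightarrow> real) \<Rightarrow> (real^'m \<Rightarrow> complex) \<Rightarrow> bool"
where
  "mod_gaussian M X Q \<Phi> \<longleftrightarrow>
     (\<forall>s. \<exists>r>0. uniform_limit (ball s r)
        (\<lambda>N t. complex_of_real (exp (Q N t / 2)) * char_vec M (X N) t) \<Phi> sequentially)"

definition balanced :: "real \<Rightarrow> (nat \<Rightarrow> real list) \<Rightarrow> bool" where
  "balanced \<mu> \<delta> \<longleftrightarrow>
     (\<forall>N\<ge>1. last (\<delta> N) \<le> hd (\<delta> N) powr \<mu>) \<and>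
     filterlim (\<lambda>N. last (\<delta> N)) at_top sequentially"

text \<open>
  A centered Gaussian vector with covariance form \<open>q\<close>, possibly degenerate: every linear
  functional \<open>t \<bullet> G\<close> is a centered real Gaussian of variance \<open>q t\<close>. The zero variance
  case is separate because \<open>normal_density 0 0\<close> is not the density of a point mass.
\<close>

definition gaussian_vector ::
  "'a measure \<Rightarrow> ('a \<Rightarrow> real^'m) \<Rightarrow> (real^'m \<Rightarrow> real) \<Rightarrow> bool"
where
  "gaussian_vector M G q \<longleftrightarrow>
     G \<in> borel_measurable M \<and>
     (\<forall>t. if q t = 0 then (AE \<omega> in M. t \<bullet> G \<omega> = 0)
          else distributed M lborel (\<lambda>\<omega>. t \<bullet> G \<omega>) (normal_density 0 (sqrt (q t))))"

lemma char_vec_gaussian_vector: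
  assumes "prob_space M" "gaussian_vector M G q" "0 \<le> q t"
  shows "char_vec M G t = exp (- complex_of_real (q t) / 2)"
proof (cases "q t = 0")
  case True
  interpret prob_space M by fact
  have [measurable]: "G \<in> borel_measurable M"
    using assms(2) by (simp add: gaussian_vector_def)
  have "AE \<omega> in M. t \<bullet> G \<omega> = 0"
    using assms(2) True unfolding gaussian_vector_def by metis
  then have "char_vec M G t = (CLINT \<omega>|M. 1)"
    unfolding char_vec_def by (intro integral_cong_AE) auto
  then show ?thesis
    using True by (simp add: prob_space)
next
  case False
  interpret prob_space M by fact
  define s where "s = sqrt (q t)"
  have s: "s > 0" "s\<^sup>2 = q t"
    using False assms(3) by (auto simp: s_def)
  have [measurable]: "G \<in> borel_measurable M"
    using assms(2) by (simp add: gaussian_vector_def)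
  have "distributed M lborel (\<lambda>\<omega>. t \<bullet> G \<omega>) (normal_density 0 s)"
    using assms(2) False unfolding gaussian_vector_def s_def by metis
  then have "distributed M lborel (\<lambda>\<omega>. (t \<bullet> G \<omega>) / s) std_normal_density"
    using normal_standard_normal_convert[of s "\<lambda>\<omega>. t \<bullet> G \<omega>" 0] s(1) by simp
  then have d: "distr M lborel (\<lambda>\<omega>. (t \<bullet> G \<omega>) / s) = std_normal_distribution"
    by (simp add: distributed_def)
  have "char_vec M G t = (CLINT \<omega>|M. iexp (s * ((t \<bullet> G \<omega>) / s)))"
    unfolding char_vec_def using s(1) by simp
  also have "\<dots> = (CLINT x|distr M lborel (\<lambda>\<omega>. (t \<bullet> G \<omega>) / s). iexp (s * x))"
    by (subst integral_distr) auto
  also have "\<dots> = char std_normal_distribution s"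
    unfolding d char_def ..
  also have "\<dots> = complex_of_real (exp (- (s\<^sup>2) / 2))"
    by (simp add: char_std_normal_distribution)
  also have "\<dots> = exp (- complex_of_real (q t) / 2)"
    by (simp add: s(2) flip: exp_of_real)
  finally show ?thesis .
qed

definition C1_on :: "('a::real_normed_vector \<Rightarrow> 'b::real_normed_vector) \<Rightarrow> 'a set \<Rightarrow> bool" where
  "C1_on f S \<longleftrightarrow>
     (\<exists>f' :: 'a \<Rightarrow> 'a \<Rightarrow>\<^sub>L 'b.
        (\<forall>x\<in>S. (f has_derivative blinfun_apply (f' x)) (at x)) \<and> continuous_on S f')"

definition exp_growth :: "(real^'m \<Rightarrow> complex) \<Rightarrow> real \<Rightarrow> real \<Rightarrow> bool" where
  "exp_growth \<Phi> A \<beta> \<longleftrightarrow> (\<exists>B. \<forall>t. norm (\<Phi> t) \<le> B * exp (\<beta> * norm t powr A))"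

text \<open>
  Validity of \<open>E(exp(i t \<bullet> X\<^sub>N)) = \<Phi>(t) exp(-Q\<^sub>N(t)/2) {1 + O(exp(-\<alpha> \<sigma>\<^sub>N\<^sup>C))}\<close> for
  \<open>\<parallel>t\<parallel> \<le> \<sigma>\<^sub>N\<^sup>a\<close>, with implied constant \<open>c\<close> and with \<open>\<sigma>\<^sub>N\<close> the product of the list \<open>\<delta> N\<close>.
\<close>

definition char_approx ::
  "'a measure \<Rightarrow> (nat \<Rightarrow> 'a \<Rightarrow> real^'m) \<Rightarrow> (nat \<Rightarrow> real^'m \<Rightarrow> real) \<Rightarrow> (nat \<Rightarrow> real list) \<Rightarrow>
   (real^'m \<Rightarrow> complex) \<Rightarrow> real \<Rightarrow> real \<Rightarrow> real \<Rightarrow> real \<Rightarrow> bool"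
where
  "char_approx M X Q \<delta> \<Phi> a \<alpha> C c \<longleftrightarrow>
     (\<forall>N\<ge>1. \<forall>t. norm t \<le> prod_list (\<delta> N) powr a \<longrightarrow>
        (\<exists>e. norm e \<le> c * (1 / exp (\<alpha> * prod_list (\<delta> N) powr C)) \<and>
             char_vec M (X N) t = \<Phi> t * complex_of_real (exp (- Q N t / 2)) * (1 + e)))"

text \<open>
  The hypotheses on the sequences \<open>X\<^sub>N\<close>, \<open>Q\<^sub>N\<close>: here \<open>\<delta> N\<close> lists the eigenvalues of \<open>Q N\<close>.
\<close>

definition balanced_mod_gaussian ::
  "'a measure \<Rightarrow> (nat \<Rightarrow> 'a \<Rightarrow> real^'m) \<Rightarrow> (nat \<Rightarrow> real^'m \<Rightarrow> real) \<Rightarrow> (nat \<Rightarrow> real list) \<Rightarrow>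
   real \<Rightarrow> (real^'m \<Rightarrow> complex) \<Rightarrow> bool"
where
  "balanced_mod_gaussian M X Q \<delta> \<mu> \<Phi> \<longleftrightarrow>
     prob_space M \<and> (\<forall>N\<ge>1. X N \<in> borel_measurable M) \<and>
     (\<forall>N\<ge>1. nonneg_quadratic_form (Q N) \<and> eigenvalue_list (Q N) (\<delta> N)) \<and>
     mod_gaussian M X Q \<Phi> \<and> 0 < \<mu> \<and> balanced \<mu> \<delta> \<and>
     (\<forall>N\<ge>1. 1 \<le> prod_list (\<delta> N))"

end

theory Submission
  imports Defs "HOL-Real_Asymp.Real_Asymp"
begin

text \<open>
  The indicator of a box is sandwiched between functions of exponential type. In one dimension,
  integrating a kernel with Fourier transform \<open>(1 - s\<^sup>2)\<^sup>2\<close> on \<open>[-1, 1]\<close> gives a smoothed step whose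
  distance from the sign function is \<open>O(1 / (1 + y\<^sup>2))\<close>, and this error is dominated by the Fourier
  transform of \<open>sinh (1 - \<bar>s\<bar>)\<close> on \<open>[-1, 1]\<close>, which is of exact order \<open>1 / (1 + y\<^sup>2)\<close>. Rescaling to
  frequencies at most \<open>T\<close>, the box probability of a random vector is given, up to \<open>O(1/T)\<close> times the
  integral of a majorant of the characteristic function, by an integral of that characteristic
  function over the cube \<open>[-T, T]\<^sup>m\<close>. There is no contribution from higher frequencies, which makes the
  constants independent of \<open>D\<close> and \<open>\<mu>\<close>.

  With \<open>S = \<sigma>\<^sub>N powr (1/D)\<close> and \<open>T = S / m\<close>, the lower bound on \<open>D\<close> yields \<open>S powr A \<le> sqrt \<delta>\<^sub>1\<close> and
  \<open>S powr A \<le> (\<sigma>\<^sub>N powr C) powr (3/4)\<close>, with room to replace \<open>A\<close> by an exponent depending only on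
  \<open>\<Phi>\<close>. Hence the characteristic functions of \<open>X\<^sub>N\<close> and \<open>G\<^sub>N\<close> differ by \<open>O(exp (- Q\<^sub>N(t) / 4) / S)\<close> for
  \<open>\<parallel>t\<parallel> \<le> S\<close>, and the Gaussian integral contributes the factor \<open>1 / sqrt \<sigma>\<^sub>N\<close>.
\<close>

section \<open>A band-limited step function\<close>

text \<open>The value 1 at the origin gives the smoothed step its limits 1/2 and -1/2. The double
  zeros at 1 and -1 make the extension by zero continuously differentiable, hence the transform
  decays fast enough to be integrated back from infinity.\<close>

definition step_kernel :: "real \<Rightarrow> real" where
  "step_kernel s = (1 - s\<^sup>2)\<^sup>2 * indicator {-1..1} s"

definition cusp_kernel :: "real \<Rightarrow> real" where
  "cusp_kernel s = sinh (1 - \<bar>s\<bar>) * indicator {-1..1} s"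

text \<open>The factor \<open>y * sinc (s * y)\<close> is \<open>sin (s * y) / s\<close> with its
  removable singularity at \<open>s = 0\<close> filled in. So this is the odd primitive of the
  Fourier transform of \<open>step_kernel\<close>, divided by \<open>2 * pi\<close>.\<close>

definition smooth_step :: "real \<Rightarrow> real" where
  "smooth_step y = (LBINT s. step_kernel s * (y * sinc (s * y))) / (2 * pi)"

text \<open>In the sense of distributions, \<open>cusp_kernel\<close> minus its second derivative is
  \<open>2 * cosh 1\<close> times the point mass at 0 minus the unit point masses at 1 and -1.
  Taking Fourier transforms and dividing by \<open>1 + y\<^sup>2\<close> yields this
  formula.\<close>

definition cusp_transform :: "real \<Rightarrow> real" where
  "cusp_transform y = 2 * (cosh 1 - cos y) / (1 + y\<^sup>2)"

lemma step_kernel_measurable [measurable]: "step_kernel \<in> borel_measurable borel"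
  unfolding step_kernel_def[abs_def] by measurable

lemma cusp_kernel_measurable [measurable]: "cusp_kernel \<in> borel_measurable borel"
proof -
  have "(\<lambda>s::real. sinh (1 - \<bar>s\<bar>)) \<in> borel_measurable borel"
    by (intro borel_measurable_continuous_onI continuous_intros)
  then show ?thesis
    unfolding cusp_kernel_def[abs_def] by measurable
qed

lemma step_kernel_even: "step_kernel (- s) = step_kernel s"
  by (auto simp: step_kernel_def indicator_def)

lemma cusp_kernel_even: "cusp_kernel (- s) = cusp_kernel s"
  by (auto simp: cusp_kernel_def indicator_def)

lemma step_kernel_bounds: "0 \<le> step_kernel s" "step_kernel s \<le> indicator {-1..1} s"
proof -
  have "(1 - s\<^sup>2)\<^sup>2 \<le> 1" if "s \<in> {-1..1}"
  proof -
    have "s\<^sup>2 \<le> 1" using that by (simp add: abs_square_le_1 abs_le_iff)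
    then have "\<bar>1 - s\<^sup>2\<bar> \<le> 1" by (simp add: abs_le_iff)
    then show ?thesis by (simp add: abs_square_le_1)
  qed
  then show "0 \<le> step_kernel s" "step_kernel s \<le> indicator {-1..1} s"
    by (auto simp: step_kernel_def indicator_def)
qed

lemma cusp_kernel_bounds: "0 \<le> cusp_kernel s" "cusp_kernel s \<le> 2 * indicator {-1..1} s"
proof -
  have "sinh x \<le> 2" if "x \<le> 1" for x :: real
  proof -
    have "sinh x \<le> sinh 1" using that by simp
    also have "\<dots> \<le> exp 1 / 2" by (simp add: sinh_field_def)
    also have "\<dots> \<le> 2" using exp_le by simp
    finally show ?thesis .
  qed
  then show "0 \<le> cusp_kernel s" "cusp_kernel s \<le> 2 * indicator {-1..1} s"
    by (auto simp: cusp_kernel_def indicator_def)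
qed

lemma sinc_bound: "\<bar>sinc x\<bar> \<le> 1"
  using abs_sin_x_le_abs_x[of x] by (auto simp: divide_simps)

lemma DERIV_Si_fun [derivative_intros]:
  assumes "(f has_real_derivative f') (at x)"
  shows "((\<lambda>x. Si (f x)) has_real_derivative sinc (f x) * f') (at x)"
  by (rule DERIV_chain2[OF DERIV_Si assms])

lemma Si_minus: "Si (- y) = - Si y"
  using Si_neg[of y] Si_neg[of "- y"] by (cases "0 \<le> y") auto

text \<open>The exact value makes the approach to the limit accessible: \<open>Si\<close> carries
  the limit, and the other terms are boundary terms of repeated integration by parts.\<close>

lemma smooth_step_eq:
  assumes "y \<noteq> 0"
  shows "pi * smooth_step y =
    Si y + cos y / y + sin y / y^2 + 6 * cos y / y^3 - 6 * sin y / y^4"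
proof -
  define u where "u = inverse y"
  have yu: "y * u = 1" using assms by (simp add: u_def)
  \<comment> \<open>An antiderivative of the integrand: its \<open>sinc\<close> part gives
    \<open>Si\<close>, and the remaining \<open>(t^3 - 2 * t) * sin (t * y)\<close> is integrated by
    parts until the polynomial is exhausted. With \<open>u\<close> in place of \<open>1 / y\<close>,
    checking the derivative is an algebraic consequence of \<open>y * u = 1\<close>.\<close>
  define F where "F t = Si (t * y) - (t^3 - 2 * t) * cos (t * y) * u
    + (3 * t\<^sup>2 - 2) * sin (t * y) * u^2 + 6 * t * cos (t * y) * u^3 - 6 * sin (t * y) * u^4" for t
  have D: "(F has_real_derivative ((1 - t\<^sup>2)\<^sup>2 * (y * sinc (t * y)))) (at t)" for t
  proof -
    have e: "(1 - t\<^sup>2)\<^sup>2 * (y * sinc (t * y)) = sinc (t * y) * y + (t^3 - 2 * t) * sin (t * y)"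
    proof (cases "t = 0")
      case False
      then show ?thesis using assms
        by (simp add: field_simps) algebra
    qed simp
    define G where "G = - ((3 * t^2 - 2) * cos (t * y) * u) + (t^3 - 2 * t) * (sin (t * y) * y) * u
      + 6 * t * sin (t * y) * u^2 + (3 * t\<^sup>2 - 2) * (cos (t * y) * y) * u^2
      + 6 * cos (t * y) * u^3 - 6 * t * (sin (t * y) * y) * u^3 - 6 * (cos (t * y) * y) * u^4"
    have G: "G = (t^3 - 2 * t) * sin (t * y)"
      unfolding G_def using yu by algebra
    have "(F has_real_derivative (sinc (t * y) * y + G)) (at t)"
      unfolding F_def G_def
      by (rule derivative_eq_intros refl)+ (simp add: algebra_simps)
    then show ?thesis unfolding e G .
  qed
  have "(\<integral>t. (1 - t\<^sup>2)\<^sup>2 * (y * sinc (t * y)) * indicator {-1..1} t \<partial>lborel) = F 1 - F (-1)"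
    by (intro integral_FTC_Icc_real D continuous_intros isCont_o2[OF _ isCont_sinc]) auto
  then have "2 * pi * smooth_step y = F 1 - F (-1)"
    by (simp add: smooth_step_def step_kernel_def mult_ac)
  also have "F (-1) = - F 1"
    by (simp add: F_def Si_minus)
  also have "F 1 = Si y + cos y / y + sin y / y^2 + 6 * cos y / y^3 - 6 * sin y / y^4"
    by (simp add: F_def u_def field_simps)
  finally show ?thesis by simp
qed

lemma step_kernel_integrable: "integrable lborel step_kernel"
proof (rule Bochner_Integration.integrable_bound)
  show "integrable lborel (\<lambda>x::real. 1 * indicator {-1..1} x :: real)" by simp
qed (use step_kernel_bounds in auto)

lemma cusp_kernel_integrable: "integrable lborel cusp_kernel"
proof (rule Bochner_Integration.integrable_bound)
  show "integrable lborel (\<lambda>x::real. 2 * indicator {-1..1} x :: real)" by simp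
qed (use cusp_kernel_bounds in auto)

lemma smooth_step_minus: "smooth_step (- y) = - smooth_step y"
  using sinc_neg by (simp only: smooth_step_def mult_minus_left mult_minus_right minus_divide_left
      Bochner_Integration.integral_minus)

lemma smooth_step_small:
  assumes "\<bar>y\<bar> \<le> 1"
  shows "\<bar>smooth_step y\<bar> \<le> 1 / 2"
proof -
  have i: "integrable lborel (\<lambda>x::real. indicator {-1..1} x :: real)"
    by (rule integrable_real_indicator) auto
  have b: "\<bar>step_kernel s * (y * sinc (s * y))\<bar> \<le> indicator {-1..1} s" for s
  proof -
    have "\<bar>step_kernel s * (y * sinc (s * y))\<bar> = step_kernel s * (\<bar>y\<bar> * \<bar>sinc (s * y)\<bar>)"
      using step_kernel_bounds[of s] by (simp only: abs_mult abs_of_nonneg)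
    also have "\<dots> \<le> indicator {-1..1} s * (1 * 1)"
      using assms by (intro mult_mono step_kernel_bounds sinc_bound) auto
    finally show ?thesis by simp
  qed
  have "\<bar>LBINT s. step_kernel s * (y * sinc (s * y))\<bar> \<le> (LBINT s. \<bar>step_kernel s * (y * sinc (s * y))\<bar>)"
    by (rule integral_abs_bound)
  also have "\<dots> \<le> (LBINT s::real. indicator {-1..1} s)"
    by (intro integral_mono' i b) auto
  also have "\<dots> = 2" by simp
  finally show ?thesis
    using pi_gt3 by (simp add: smooth_step_def abs_divide field_simps)
qed

text \<open>Differentiating the explicit formula cancels everything of order larger than
  \<open>1 / y^3\<close>. Integrating this bound back from infinity, where \<open>Si\<close> tends
  to \<open>pi / 2\<close>, gives the decay.\<close>

lemma smooth_step_large: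
  assumes "1 \<le> y"
  shows "\<bar>smooth_step y - 1 / 2\<bar> \<le> 28 / y\<^sup>2"
proof -
  define E where "E y = Si y + cos y / y + sin y / y^2 + 6 * cos y / y^3 - 6 * sin y / y^4" for y
  define k where "k y = - 8 * sin y / y^3 - 24 * cos y / y^4 + 24 * sin y / y^5" for y :: real
  have D: "(E has_real_derivative k y) (at y)" if "y \<ge> 1" for y
    unfolding E_def k_def
    by (rule derivative_eq_intros refl | use that in force)+
       (use that in \<open>simp add: field_simps eval_nat_numeral\<close>)
  \<comment> \<open>The constant is 8 + 24 + 24, the sum of the coefficients of \<open>k\<close>;
    the 28 below is half of it, from integrating \<open>56 / y^3\<close>.\<close>
  have K: "\<bar>k y\<bar> \<le> 56 / y^3" if "y \<ge> 1" for y
  proof -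
    have "\<bar>k y\<bar> \<le> \<bar>8 * sin y / y^3\<bar> + \<bar>24 * cos y / y^4\<bar> + \<bar>24 * sin y / y^5\<bar>"
      unfolding k_def by linarith
    also have "\<dots> \<le> 8 / y^3 + 24 / y^3 + 24 / y^3"
      unfolding abs_divide abs_mult
      using that abs_sin_le_one[of y] abs_cos_le_one[of y]
      by (intro add_mono frac_le) (auto simp: power_increasing simp flip: power_abs)
    finally show ?thesis by simp
  qed
  have lim: "(E \<longlongrightarrow> pi / 2) at_top"
  proof -
    have "((\<lambda>y. cos y / y + sin y / y^2 + 6 * cos y / y^3 - 6 * sin y / y^4 :: real) \<longlongrightarrow> 0) at_top"
      by real_asymp
    from tendsto_add[OF Si_at_top this] show ?thesis
      by (simp add: E_def[abs_def] algebra_simps)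
  qed
  have l0: "((\<lambda>y. 28 / y\<^sup>2 :: real) \<longlongrightarrow> 0) at_top"
    by real_asymp
  \<comment> \<open>A nondecreasing function stays below its limit: the derivative of
    \<open>E y - 28 / y\<^sup>2\<close> is \<open>k y + 56 / y^3\<close>, which is nonnegative. The
    opposite bound uses \<open>E y + 28 / y\<^sup>2\<close> in the same way.\<close>
  have "E y - 28 / y\<^sup>2 \<le> pi / 2"
  proof (rule tendsto_lowerbound[OF tendsto_diff[OF lim l0, simplified]])
    show "\<forall>\<^sub>F x in at_top. E y - 28 / y\<^sup>2 \<le> E x - 28 / x\<^sup>2"
      using eventually_ge_at_top[of y]
    proof eventually_elim
      case (elim x)
      show ?case
      proof (rule DERIV_nonneg_imp_nondecreasing[OF elim])
        fix z assume "y \<le> z" "z \<le> x"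
        then have z: "z \<ge> 1" using assms by simp
        have "((\<lambda>x. E x - 28 / x\<^sup>2) has_real_derivative (k z + 56 / z^3)) (at z)"
          by (rule derivative_eq_intros D refl z | use z in force)+
             (use z in \<open>simp add: field_simps eval_nat_numeral\<close>)
        then show "\<exists>d. ((\<lambda>x. E x - 28 / x\<^sup>2) has_real_derivative d) (at z) \<and> 0 \<le> d"
          using K[OF z] by (auto intro!: exI[of _ "k z + 56 / z^3"])
      qed
    qed
  qed simp
  moreover have "pi / 2 \<le> E y + 28 / y\<^sup>2"
  proof (rule tendsto_upperbound[OF tendsto_add[OF lim l0, simplified]])
    show "\<forall>\<^sub>F x in at_top. E x + 28 / x\<^sup>2 \<le> E y + 28 / y\<^sup>2"
      using eventually_ge_at_top[of y]
    proof eventually_elim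
      case (elim x)
      show ?case
      proof (rule DERIV_nonpos_imp_nonincreasing[OF elim])
        fix z assume "y \<le> z" "z \<le> x"
        then have z: "z \<ge> 1" using assms by simp
        have "((\<lambda>x. E x + 28 / x\<^sup>2) has_real_derivative (k z - 56 / z^3)) (at z)"
          by (rule derivative_eq_intros D refl z | use z in force)+
             (use z in \<open>simp add: field_simps eval_nat_numeral\<close>)
        then show "\<exists>d. ((\<lambda>x. E x + 28 / x\<^sup>2) has_real_derivative d) (at z) \<and> d \<le> 0"
          using K[OF z] by (auto intro!: exI[of _ "k z - 56 / z^3"])
      qed
    qed
  qed simp
  ultimately have "\<bar>E y - pi / 2\<bar> \<le> 28 / y\<^sup>2" by linarith
  moreover have "E y = pi * smooth_step y"
    using assms by (subst smooth_step_eq) (auto simp: E_def)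
  moreover have "pi * smooth_step y - pi / 2 = pi * (smooth_step y - 1 / 2)"
    by (simp add: algebra_simps)
  ultimately have "pi * \<bar>smooth_step y - 1 / 2\<bar> \<le> 28 / y\<^sup>2"
    by (simp add: abs_mult)
  moreover have "1 * \<bar>smooth_step y - 1 / 2\<bar> \<le> pi * \<bar>smooth_step y - 1 / 2\<bar>"
    using pi_gt3 by (intro mult_right_mono) auto
  ultimately show ?thesis unfolding mult_1 by (rule order_trans[rotated])
qed

text \<open>From \<open>exp 1 \<ge> 5/2\<close> one gets \<open>2 * cosh 1 \<ge> 5/2\<close>, so the
  numerator is at least 1/2 for every \<open>y\<close>. A triangular kernel would not do here, as
  its transform has zeros.\<close>

lemma cusp_transform_ge: "(1 / 2) / (1 + y\<^sup>2) \<le> cusp_transform y"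
proof -
  have "5 / 2 \<le> exp (1::real)"
    using exp_lower_Taylor_quadratic[of 1] by simp
  then have "5 / 2 \<le> 2 * cosh (1::real)"
    by (simp add: cosh_field_def exp_minus add_increasing2)
  then have "1 / 2 \<le> 2 * (cosh 1 - cos y)"
    unfolding right_diff_distrib using cos_le_one[of y] by linarith
  then show ?thesis
    unfolding cusp_transform_def by (intro divide_right_mono) auto
qed

text \<open>Here \<open>s\<close> is half the sign of \<open>y\<close>, with any value in
  [-1/2, 1/2] allowed at the jump so that either one-sided convention can be used. Near 0 both terms
  are at most 1/2 in size; elsewhere the decay of the smoothed step and its oddness apply.\<close>

lemma smooth_step_approx:
  assumes "y > 0 \<Longrightarrow> s = 1 / 2" "y < 0 \<Longrightarrow> s = - 1 / 2" "\<bar>s\<bar> \<le> 1 / 2"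
  shows "\<bar>smooth_step y - s\<bar> \<le> 120 * cusp_transform y"
proof -
  have "\<bar>smooth_step y - s\<bar> \<le> 60 * (1 / (1 + y\<^sup>2))"
  proof (cases "\<bar>y\<bar> \<le> 1")
    case True
    have "1 + y\<^sup>2 \<le> 2" using True by (simp add: abs_square_le_1)
    then have "1 \<le> 60 * (1 / (1 + y\<^sup>2))" by (simp add: field_simps add_pos_nonneg)
    then show ?thesis using smooth_step_small[OF True] assms(3) by linarith
  next
    case False
    have "\<bar>smooth_step y - s\<bar> = \<bar>smooth_step \<bar>y\<bar> - 1 / 2\<bar>"
      using assms(1,2) False smooth_step_minus[of y] by (cases "y > 0") (auto simp: abs_if)
    also have "\<dots> \<le> 28 / \<bar>y\<bar>\<^sup>2" using False by (intro smooth_step_large) auto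
    also have "\<dots> \<le> 60 * (1 / (1 + y\<^sup>2))"
    proof -
      have y: "1 \<le> y\<^sup>2" using False one_le_power[of "\<bar>y\<bar>" 2] by simp
      then have "28 / \<bar>y\<bar>\<^sup>2 \<le> 56 / (1 + y\<^sup>2)"
        using frac_le[of 56 56 "1 + y\<^sup>2" "2 * y\<^sup>2"] by (simp add: add_pos_nonneg)
      also have "\<dots> \<le> 60 * (1 / (1 + y\<^sup>2))" by (simp add: divide_right_mono)
      finally show ?thesis .
    qed
    finally show ?thesis .
  qed
  also have "\<dots> \<le> 120 * cusp_transform y"
    using mult_left_mono[OF cusp_transform_ge[of y], of 120] by (simp only: times_divide_eq_right) simp
  finally show ?thesis .
qed

lemma cusp_transform_eq: "(LBINT s. cusp_kernel s * cos (s * y)) = cusp_transform y"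
proof -
  have pos: "1 + y\<^sup>2 > 0" by (simp add: add_pos_nonneg)
  define u where "u = inverse (1 + y\<^sup>2)"
  have u: "(1 + y\<^sup>2) * u = 1" using pos by (simp add: u_def)
  define F where "F t = (y * sinh (1 - t) * sin (t * y) - cosh (1 - t) * cos (t * y)) * u" for t
  have F: "(F has_real_derivative (sinh (1 - t) * cos (t * y))) (at t)" for t
  proof -
    have "(F has_real_derivative (((1 + y\<^sup>2) * u) * (sinh (1 - t) * cos (t * y)))) (at t)"
      unfolding F_def
      by (rule derivative_eq_intros refl)+ (simp add: algebra_simps power2_eq_square)
    then show ?thesis using u by simp
  qed
  have F': "((\<lambda>t. - F (- t)) has_real_derivative (sinh (1 + t) * cos (t * y))) (at t)" for t
    by (rule derivative_eq_intros DERIV_chain2[OF F] refl)+ simp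
  have 1: "has_bochner_integral lborel (\<lambda>t. sinh (1 - t) * cos (t * y) * indicator {0..1} t) (F 1 - F 0)"
    by (intro has_bochner_integral_FTC_Icc_real F continuous_intros) auto
  have 2: "has_bochner_integral lborel (\<lambda>t. sinh (1 + t) * cos (t * y) * indicator {-1..0} t) (- F (- 0) - (- F (- (- 1))))"
    by (intro has_bochner_integral_FTC_Icc_real F' continuous_intros) auto
  \<comment> \<open>The kernel is smooth on each side of 0, so each half has an elementary
    antiderivative. Both half intervals contain 0, which is why the splitting holds only almost
    everywhere.\<close>
  have "(LBINT t. cusp_kernel t * cos (t * y)) = (LBINT t. sinh (1 - t) * cos (t * y) * indicator {0..1} t
     + sinh (1 + t) * cos (t * y) * indicator {-1..0} t)"
  proof (rule integral_cong_AE)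
    show "AE t in lborel. cusp_kernel t * cos (t * y) = sinh (1 - t) * cos (t * y) * indicator {0..1} t
     + sinh (1 + t) * cos (t * y) * indicator {-1..0} t"
      using AE_lborel_singleton[of "0::real"]
      by eventually_elim (auto simp: cusp_kernel_def indicator_def)
    show "(\<lambda>t. cusp_kernel t * cos (t * y)) \<in> borel_measurable lborel" by measurable
    show "(\<lambda>t. sinh (1 - t) * cos (t * y) * indicator {0..1} t
     + sinh (1 + t) * cos (t * y) * indicator {-1..0} t) \<in> borel_measurable lborel"
      using has_bochner_integral_add[OF 1 2] by (auto dest!: has_bochner_integral_integrable)
  qed
  also have "\<dots> = 2 * (F 1 - F 0)"
    using has_bochner_integral_add[OF 1 2] by (simp add: has_bochner_integral_integral_eq)
  also have "\<dots> = cusp_transform y"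
    by (simp add: F_def cusp_transform_def u_def divide_inverse algebra_simps)
  finally show ?thesis .
qed

lemma even_fourier_integral:
  fixes f :: "real \<Rightarrow> real"
  assumes f: "integrable lborel f" and even: "\<And>s. f (- s) = f s"
  shows "(CLBINT s. f s * iexp (s * x)) = complex_of_real (LBINT s. f s * cos (s * x))"
proof -
  have [measurable]: "f \<in> borel_measurable borel" using f by auto
  have i: "integrable lborel (\<lambda>s. f s * cos (s * x))" "integrable lborel (\<lambda>s. f s * sin (s * x))"
    by (rule Bochner_Integration.integrable_bound[OF f];
        auto simp: abs_mult intro!: mult_left_le)+
  have "(LBINT s. f s * sin (s * x)) = - (LBINT s. f s * sin (s * x))"
    using lborel_integral_real_affine[of "-1" "\<lambda>s. f s * sin (s * x)" 0] by (simp add: even)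
  then have 0: "(LBINT s. f s * sin (s * x)) = 0" by simp
  have "(CLBINT s. f s * iexp (s * x)) = (CLBINT s. of_real (f s * cos (s * x)) + \<i> * of_real (f s * sin (s * x)))"
    by (intro Bochner_Integration.integral_cong refl) (simp add: exp_Euler ring_distribs mult_ac cos_of_real sin_of_real flip: of_real_mult)
  also have "\<dots> = of_real (LBINT s. f s * cos (s * x)) + \<i> * of_real (LBINT s. f s * sin (s * x))"
    using i[THEN integrable_of_real[where 'a=complex]]
    by (simp del: of_real_mult add: Bochner_Integration.integral_add)
  finally show ?thesis by (simp add: 0)
qed

section \<open>Band-limited approximation of intervals and boxes\<close>

definition window :: "real \<Rightarrow> real \<Rightarrow> real \<Rightarrow> real" where
  "window T \<epsilon> x = smooth_step (T * (x + \<epsilon>)) - smooth_step (T * (x - \<epsilon>))"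

definition window_error :: "real \<Rightarrow> real \<Rightarrow> real \<Rightarrow> real" where
  "window_error T \<epsilon> x = 120 * (cusp_transform (T * (x + \<epsilon>)) + cusp_transform (T * (x - \<epsilon>)))"

text \<open>The frequency-side form of \<open>window\<close>:
  \<open>\<epsilon> * sinc (s * \<epsilon>) / pi\<close> is the Fourier density of the indicator of
  the interval of radius \<open>\<epsilon>\<close>, and \<open>step_kernel (s / T)\<close> cuts it
  off at frequency \<open>T\<close>.\<close>

definition window_kernel :: "real \<Rightarrow> real \<Rightarrow> real \<Rightarrow> real" where
  "window_kernel T \<epsilon> s = step_kernel (s / T) * (\<epsilon> * sinc (s * \<epsilon>)) / pi"

text \<open>Shifting the majorant to the two endpoints multiplies its kernel by
  \<open>2 * cos (s * \<epsilon>)\<close>, which accounts for 240 in place of 120; the factor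
  \<open>1 / T\<close> comes from rescaling.\<close>

definition window_error_kernel :: "real \<Rightarrow> real \<Rightarrow> real \<Rightarrow> real" where
  "window_error_kernel T \<epsilon> s = 240 / T * cusp_kernel (s / T) * cos (s * \<epsilon>)"

lemma window_approx:
  assumes "T > 0" "\<epsilon> > 0"
  shows "\<bar>window T \<epsilon> x - indicator {x. \<bar>x\<bar> < \<epsilon>} x\<bar> \<le> window_error T \<epsilon> x"
proof -
  define u v where "u = T * (x + \<epsilon>)" and "v = T * (x - \<epsilon>)"
  \<comment> \<open>The two half-signs round the jump in opposite directions, so that
    \<open>a - b\<close> vanishes at both endpoints and equals the indicator of the open interval
    everywhere.\<close>
  define a b :: real where "a = (if u > 0 then 1 / 2 else - 1 / 2)"
    and "b = (if v < 0 then - 1 / 2 else 1 / 2)"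
  have "v < u" using assms by (simp add: u_def v_def)
  have iff: "\<bar>x\<bar> < \<epsilon> \<longleftrightarrow> u > 0 \<and> v < 0"
    using assms by (auto simp: u_def v_def zero_less_mult_iff mult_less_0_iff)
  have "indicator {x. \<bar>x\<bar> < \<epsilon>} x = a - b"
    using \<open>v < u\<close> by (auto simp: iff a_def b_def indicator_def)
  moreover have "\<bar>smooth_step u - a\<bar> \<le> 120 * cusp_transform u"
    by (rule smooth_step_approx) (auto simp: a_def)
  moreover have "\<bar>smooth_step v - b\<bar> \<le> 120 * cusp_transform v"
    by (rule smooth_step_approx) (auto simp: b_def)
  ultimately show ?thesis
    unfolding window_def window_error_def unfolding u_def[symmetric] v_def[symmetric] distrib_left[of 120] by linarith
qed

lemma window_kernel_even: "window_kernel T \<epsilon> (- s) = window_kernel T \<epsilon> s"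
  using sinc_neg[of "s * \<epsilon>"] step_kernel_even[of "s / T"]
  by (simp only: window_kernel_def mult_minus_left minus_divide_left[symmetric])

lemma window_error_kernel_even: "window_error_kernel T \<epsilon> (- s) = window_error_kernel T \<epsilon> s"
  using cusp_kernel_even[of "s / T"] by (simp add: window_error_kernel_def)

lemma window_kernel_bound:
  assumes "T > 0" "0 < \<epsilon>" "\<epsilon> \<le> 1"
  shows "\<bar>window_kernel T \<epsilon> s\<bar> \<le> indicator {-T..T} s"
proof -
  have "\<bar>window_kernel T \<epsilon> s\<bar> = step_kernel (s / T) * (\<epsilon> * \<bar>sinc (s * \<epsilon>)\<bar>) / pi"
    using step_kernel_bounds(1)[of "s / T"] assms
    by (simp only: window_kernel_def abs_mult abs_divide abs_of_nonneg pi_ge_zero less_imp_le)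
  also have "\<dots> \<le> indicator {-1..1} (s / T) * (1 * 1) / 1"
    using assms pi_gt3
    by (intro frac_le mult_mono step_kernel_bounds sinc_bound mult_nonneg_nonneg) auto
  also have "\<dots> = indicator {-T..T} s"
    using assms by (auto simp: indicator_def field_simps)
  finally show ?thesis .
qed

lemma window_error_kernel_bound:
  assumes "T > 0"
  shows "\<bar>window_error_kernel T \<epsilon> s\<bar> \<le> 480 / T * indicator {-T..T} s"
proof -
  have "\<bar>window_error_kernel T \<epsilon> s\<bar> = 240 / T * cusp_kernel (s / T) * \<bar>cos (s * \<epsilon>)\<bar>"
    using cusp_kernel_bounds(1)[of "s / T"] assms
    by (simp add: window_error_kernel_def abs_mult)
  also have "\<dots> \<le> 240 / T * (2 * indicator {-1..1} (s / T)) * 1"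
    using assms cusp_kernel_bounds(1)[of "s / T"]
    by (intro mult_mono cusp_kernel_bounds) auto
  also have "\<dots> = 480 / T * indicator {-T..T} s"
    using assms by (auto simp: indicator_def field_simps)
  finally show ?thesis .
qed

lemma window_kernel_measurable [measurable]: "window_kernel T \<epsilon> \<in> borel_measurable borel"
  unfolding window_kernel_def[abs_def] by measurable

lemma window_error_kernel_measurable [measurable]:
  "window_error_kernel T \<epsilon> \<in> borel_measurable borel"
  unfolding window_error_kernel_def[abs_def] by measurable

lemma kernels_integrable:
  assumes "T > 0" "0 < \<epsilon>" "\<epsilon> \<le> 1"
  shows "integrable lborel (window_kernel T \<epsilon>)" "integrable lborel (window_error_kernel T \<epsilon>)"
proof -
  have "integrable lborel (\<lambda>x::real. indicator {-T..T} x :: real)"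
    using assms by (intro integrable_real_indicator) auto
  then have i: "integrable lborel (\<lambda>x::real. c * indicator {-T..T} x :: real)" for c
    by simp
  have n: "c * indicator {-T..T} s = norm (c * indicator {-T..T} s)" if "c \<ge> 0" for c s :: real
    using that by (auto simp: indicator_def)
  show "integrable lborel (window_kernel T \<epsilon>)"
    by (rule Bochner_Integration.integrable_bound[OF i[of 1]])
       (use window_kernel_bound[OF assms] in auto)
  show "integrable lborel (window_error_kernel T \<epsilon>)"
    by (rule Bochner_Integration.integrable_bound[OF i[of "480 / T"]])
       (use window_error_kernel_bound[OF assms(1)] assms in \<open>auto simp: abs_mult\<close>)
qed

lemma window_kernel_transform:
  assumes "T > 0"
  shows "(LBINT s. window_kernel T \<epsilon> s * cos (s * x)) = window T \<epsilon> x"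
proof -
  define u v where "u = T * (x + \<epsilon>)" and "v = T * (x - \<epsilon>)"
  \<comment> \<open>This is the identity \<open>2 * sin (t * T * \<epsilon>) * cos (t * T * x) = sin
    (t * u) - sin (t * v)\<close> divided by \<open>2 * t\<close>, with \<open>t = 0\<close> treated
    separately. It turns one modulated integral into a difference of two smoothed steps.\<close>
  have prod: "T * \<epsilon> * sinc (t * T * \<epsilon>) * cos (t * T * x) = (u * sinc (t * u) - v * sinc (t * v)) / 2" for t
  proof (cases "t = 0")
    case True
    then show ?thesis by (simp add: u_def v_def algebra_simps)
  next
    case False
    have sc: "z * sinc (t * z) = sin (t * z) / t" for z using False by auto
    have "T * \<epsilon> * sinc (t * T * \<epsilon>) = sin (t * T * \<epsilon>) / t"
      using sc[of "T * \<epsilon>"] by (simp only: mult.assoc)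
    then show ?thesis
      unfolding sc using False
      by (simp add: u_def v_def distrib_left right_diff_distrib sin_add sin_diff mult.assoc add_divide_distrib diff_divide_distrib)
  qed
  have int: "integrable lborel (\<lambda>t. step_kernel t * (z * sinc (t * z)))" for z
  proof (rule Bochner_Integration.integrable_bound)
    show "integrable lborel (\<lambda>t. \<bar>z\<bar> * step_kernel t)" using step_kernel_integrable by simp
    show "AE t in lborel. norm (step_kernel t * (z * sinc (t * z))) \<le> norm (\<bar>z\<bar> * step_kernel t)"
    proof (rule AE_I2)
      fix t
      have "norm (step_kernel t * (z * sinc (t * z))) = step_kernel t * \<bar>z\<bar> * \<bar>sinc (t * z)\<bar>"
        using step_kernel_bounds(1)[of t] by (simp only: real_norm_def abs_mult abs_of_nonneg mult.assoc)
      also have "\<dots> \<le> step_kernel t * \<bar>z\<bar> * 1"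
        by (intro mult_left_mono sinc_bound mult_nonneg_nonneg step_kernel_bounds) auto
      finally show "norm (step_kernel t * (z * sinc (t * z))) \<le> norm (\<bar>z\<bar> * step_kernel t)"
        using step_kernel_bounds(1)[of t] by (simp add: abs_mult mult.commute)
    qed
  qed simp
  have "(LBINT s. window_kernel T \<epsilon> s * cos (s * x)) = T * (LBINT t. window_kernel T \<epsilon> (0 + T * t) * cos ((0 + T * t) * x))"
    using assms lborel_integral_real_affine[of T "\<lambda>s. window_kernel T \<epsilon> s * cos (s * x)" 0] by simp
  also have "\<dots> = (LBINT t. step_kernel t * (T * \<epsilon> * sinc (t * T * \<epsilon>) * cos (t * T * x)) / pi)"
    unfolding integral_mult_right_zero[symmetric]
    by (rule Bochner_Integration.integral_cong) (use assms in \<open>simp_all add: window_kernel_def mult_ac\<close>)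
  also have "\<dots> = (LBINT t. (step_kernel t * (u * sinc (t * u)) - step_kernel t * (v * sinc (t * v))) / (2 * pi))"
    unfolding prod by (rule Bochner_Integration.integral_cong) (simp_all only: right_diff_distrib diff_divide_distrib mult_ac times_divide_eq_left times_divide_eq_right divide_divide_eq_left)
  also have "\<dots> = window T \<epsilon> x"
    unfolding integral_divide_zero by (subst Bochner_Integration.integral_diff[OF int int])
      (simp add: window_def smooth_step_def diff_divide_distrib flip: u_def v_def)
  finally show ?thesis .
qed

lemma window_error_kernel_transform:
  assumes "T > 0"
  shows "(LBINT s. window_error_kernel T \<epsilon> s * cos (s * x)) = window_error T \<epsilon> x"
proof -
  define u v where "u = T * (x + \<epsilon>)" and "v = T * (x - \<epsilon>)"
  have prod: "2 * (cos (t * T * \<epsilon>) * cos (t * T * x)) = cos (t * u) + cos (t * v)" for t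
    by (simp add: u_def v_def distrib_left right_diff_distrib cos_add cos_diff mult.assoc)
  have int: "integrable lborel (\<lambda>t. cusp_kernel t * cos (t * z))" for z
    by (rule Bochner_Integration.integrable_bound[OF cusp_kernel_integrable])
       (auto simp: abs_mult intro!: mult_left_le)
  have "(LBINT s. window_error_kernel T \<epsilon> s * cos (s * x)) = T * (LBINT t. window_error_kernel T \<epsilon> (0 + T * t) * cos ((0 + T * t) * x))"
    using assms lborel_integral_real_affine[of T "\<lambda>s. window_error_kernel T \<epsilon> s * cos (s * x)" 0] by simp
  also have "\<dots> = (LBINT t. 120 * (cusp_kernel t * (2 * (cos (t * T * \<epsilon>) * cos (t * T * x)))))"
    unfolding integral_mult_right_zero[symmetric]
    by (rule Bochner_Integration.integral_cong) (use assms in \<open>simp_all add: window_error_kernel_def mult_ac\<close>)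
  also have "\<dots> = 120 * (LBINT t. cusp_kernel t * cos (t * u) + cusp_kernel t * cos (t * v))"
    unfolding prod integral_mult_right_zero by (simp only: distrib_left)
  also have "\<dots> = window_error T \<epsilon> x"
    by (subst Bochner_Integration.integral_add[OF int int])
      (simp add: window_error_def cusp_transform_eq flip: u_def v_def)
  finally show ?thesis .
qed

text \<open>The coefficient \<open>c\<close> is kept free because the product majorant needs the
  three combinations with \<open>c\<close> equal to 0, 1 and 2.\<close>

lemma window_sum_fourier:
  assumes "T > 0" "0 < \<epsilon>" "\<epsilon> \<le> 1"
  shows "(CLBINT s. (window_kernel T \<epsilon> s + c * window_error_kernel T \<epsilon> s) * iexp (s * x)) =
    complex_of_real (window T \<epsilon> x + c * window_error T \<epsilon> x)"
proof -
  note i = kernels_integrable[OF assms]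
  have j: "integrable lborel (\<lambda>s. f s * cos (s * x))" if f: "integrable lborel f" for f :: "real \<Rightarrow> real"
  proof -
    have [measurable]: "f \<in> borel_measurable borel" using f by auto
    show ?thesis by (rule Bochner_Integration.integrable_bound[OF f])
       (auto simp: abs_mult intro!: mult_left_le)
  qed
  have "(CLBINT s. (window_kernel T \<epsilon> s + c * window_error_kernel T \<epsilon> s) * iexp (s * x)) = of_real (LBINT s. (window_kernel T \<epsilon> s + c * window_error_kernel T \<epsilon> s) * cos (s * x))"
    by (rule even_fourier_integral) (use i in \<open>auto simp: window_kernel_even window_error_kernel_even\<close>)
  also have "(LBINT s. (window_kernel T \<epsilon> s + c * window_error_kernel T \<epsilon> s) * cos (s * x)) =
    (LBINT s. window_kernel T \<epsilon> s * cos (s * x) + c * (window_error_kernel T \<epsilon> s * cos (s * x)))"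
    by (simp add: algebra_simps)
  also have "\<dots> = window T \<epsilon> x + c * window_error T \<epsilon> x"
    using i by (subst Bochner_Integration.integral_add) (auto intro: j simp: window_kernel_transform window_error_kernel_transform assms)
  finally show ?thesis .
qed

section \<open>Product kernels in several variables and expectations of their transforms\<close>

lemma integral_lborel_prod:
  fixes f :: "'a::euclidean_space \<Rightarrow> real \<Rightarrow> 'b::{real_normed_field, banach, second_countable_topology}"
  assumes "\<And>b. b \<in> Basis \<Longrightarrow> integrable lborel (f b)"
  shows "integrable lborel (\<lambda>x::'a. \<Prod>b\<in>Basis. f b (x \<bullet> b))"
    and "(LINT x|lborel. (\<Prod>b\<in>Basis. f b (x \<bullet> b))) = (\<Prod>b\<in>Basis. integral\<^sup>L lborel (f b))"
proof -
  interpret product_sigma_finite "\<lambda>_::'a. lborel :: real measure" ..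
  have [measurable]: "f b \<in> borel_measurable borel" if "b \<in> Basis" for b
    using assms[OF that] by auto
  have m: "(\<lambda>x::'a. \<Prod>b\<in>Basis. f b (x \<bullet> b)) \<in> borel_measurable borel"
    by (intro borel_measurable_prod) measurable
  have g: "(\<lambda>g. \<Sum>b\<in>Basis. g b *\<^sub>R b :: 'a) \<in> measurable (\<Pi>\<^sub>M b\<in>Basis. lborel) borel"
    by (intro borel_measurable_sum borel_measurable_scaleR) auto
  have eq: "(\<Prod>b\<in>Basis. f b ((\<Sum>c\<in>Basis. g c *\<^sub>R c) \<bullet> b)) = (\<Prod>b\<in>Basis. f b (g b))" for g
    by (intro prod.cong refl) simp
  show "integrable lborel (\<lambda>x::'a. \<Prod>b\<in>Basis. f b (x \<bullet> b))"
    using product_integrable_prod[OF finite_Basis assms]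
    by (subst lborel_eq) (simp add: integrable_distr_eq[OF g m] eq)
  show "(LINT x|lborel. (\<Prod>b\<in>Basis. f b (x \<bullet> b))) = (\<Prod>b\<in>Basis. integral\<^sup>L lborel (f b))"
    using product_integral_prod[OF finite_Basis assms]
    by (subst lborel_eq) (simp add: integral_distr[OF g m] eq)
qed

text \<open>The bound avoids \<open>\<bar>p i\<bar>\<close>, so that it is again band-limited when \<open>p\<close> and \<open>h\<close> are.\<close>

lemma abs_prod_diff_le_majorant:
  fixes p q h :: "'i \<Rightarrow> real"
  assumes "finite I" "\<And>i. i \<in> I \<Longrightarrow> 0 \<le> q i" "\<And>i. i \<in> I \<Longrightarrow> \<bar>p i - q i\<bar> \<le> h i"
  shows "\<bar>(\<Prod>i\<in>I. p i) - (\<Prod>i\<in>I. q i)\<bar> \<le> (\<Prod>i\<in>I. p i + 2 * h i) - (\<Prod>i\<in>I. p i + h i)"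
  using assms
proof (induction I)
  case (insert i I)
  define P Q P1 P2 where "P = prod p I" "Q = prod q I" "P1 = (\<Prod>i\<in>I. p i + h i)"
    "P2 = (\<Prod>i\<in>I. p i + 2 * h i)"
  note d = this
  have IH: "\<bar>P - Q\<bar> \<le> P2 - P1" unfolding d using insert by simp
  have b: "0 \<le> q i" "\<bar>p i - q i\<bar> \<le> h i" using insert.prems by auto
  have b': "\<bar>p j - q j\<bar> \<le> h j" "0 \<le> q j" if "j \<in> I" for j using insert.prems that by auto
  have "q j \<le> p j + h j" if "j \<in> I" for j using b'[OF that] by linarith
  then have Q: "0 \<le> Q" "Q \<le> P1" unfolding d using insert.prems
    by (auto intro!: prod_nonneg prod_mono)
  have "p i * P - q i * Q = p i * (P - Q) + (p i - q i) * Q" by (simp add: algebra_simps)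
  then have "\<bar>p i * P - q i * Q\<bar> \<le> \<bar>p i\<bar> * \<bar>P - Q\<bar> + \<bar>p i - q i\<bar> * Q"
    using Q(1) abs_triangle_ineq[of "p i * (P - Q)" "(p i - q i) * Q"] by (simp add: abs_mult)
  \<comment> \<open>Since \<open>p i \<ge> q i - h i \<ge> - h i\<close>, the absolute value of
    \<open>p i\<close> is at most \<open>p i + 2 * h i\<close>. With this majorant the right-hand
    side collapses again to a difference of two products.\<close>
  also have "\<dots> \<le> (p i + 2 * h i) * (P2 - P1) + h i * P1"
    using b IH Q by (intro add_mono mult_mono) linarith+
  also have "\<dots> = (p i + 2 * h i) * P2 - (p i + h i) * P1" by (simp add: algebra_simps)
  finally show ?case using insert.hyps by (simp add: d)
qed simp

text \<open>Exchanging one factor at a time costs \<open>d\<close> times at most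
  \<open>B ^ card I\<close>, and there are \<open>card I\<close> exchanges.\<close>

lemma norm_prod_diff_bound:
  fixes u v :: "'i \<Rightarrow> 'b::{real_normed_field}" and B d :: real
  assumes "finite I" "\<And>i. i \<in> I \<Longrightarrow> norm (u i) \<le> B" "\<And>i. i \<in> I \<Longrightarrow> norm (v i) \<le> B"
    "\<And>i. i \<in> I \<Longrightarrow> norm (u i - v i) \<le> d" "1 \<le> B"
  shows "norm (prod u I - prod v I) \<le> card I * B ^ card I * d"
  using assms
proof (induction I)
  case (insert i I)
  have IH: "norm (prod u I - prod v I) \<le> card I * B ^ card I * d" using insert by auto
  have b: "norm (u i) \<le> B" "norm (u i - v i) \<le> d" using insert.prems by auto
  have d: "0 \<le> d" using b(2) norm_ge_zero order_trans by blast
  have V: "norm (prod v I) \<le> B ^ card I"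
    unfolding prod_norm[symmetric] using insert.prems prod_mono[of I "\<lambda>i. norm (v i)" "\<lambda>_. B"] by simp
  have "u i * prod u I - v i * prod v I = u i * (prod u I - prod v I) + (u i - v i) * prod v I"
    by (simp add: algebra_simps)
  then have "norm (u i * prod u I - v i * prod v I) \<le>
      norm (u i) * norm (prod u I - prod v I) + norm (u i - v i) * norm (prod v I)"
    by (metis norm_triangle_ineq norm_mult)
  also have "\<dots> \<le> B * (card I * B ^ card I * d) + d * B ^ card I"
    using b IH V \<open>1 \<le> B\<close> d by (intro add_mono mult_mono) auto
  also have "d * B ^ card I \<le> d * B ^ Suc (card I)"
    using \<open>1 \<le> B\<close> d by (intro mult_left_mono power_increasing) auto
  finally show ?case using insert.hyps by (simp add: algebra_simps)
qed simp

text \<open>The character \<open>iexp (t \<bullet> y)\<close> is the product of its coordinate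
  characters, so the multivariate transform splits into one-dimensional ones.\<close>

lemma prod_transform_fourier:
  fixes f g :: "real \<Rightarrow> real" and y :: "real^'m"
  assumes f: "integrable lborel f"
    and g: "\<And>x. (CLBINT s. f s * iexp (s * x)) = complex_of_real (g x)"
  shows "complex_of_real (\<Prod>b\<in>Basis. g (y \<bullet> b)) =
    (CLINT t|lborel. of_real (\<Prod>b\<in>Basis. f (t \<bullet> b)) * iexp (t \<bullet> y))"
proof -
  have [measurable]: "f \<in> borel_measurable borel" using f by auto
  have i: "integrable lborel (\<lambda>s. complex_of_real (f s) * iexp (s * z))" for z
    by (rule Bochner_Integration.integrable_bound[OF f]) (auto simp: norm_mult)
  have "complex_of_real (\<Prod>b\<in>Basis. g (y \<bullet> b)) = (\<Prod>b\<in>Basis. CLBINT s. f s * iexp (s * (y \<bullet> b)))"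
    by (simp only: g of_real_prod)
  also have "\<dots> = (CLINT t|lborel. (\<Prod>b\<in>(Basis::(real^'m) set). f (t \<bullet> b) * iexp ((t \<bullet> b) * (y \<bullet> b))))"
    by (rule integral_lborel_prod(2)[OF i, symmetric])
  also have "\<dots> = (CLINT t|lborel. of_real (\<Prod>b\<in>Basis. f (t \<bullet> b)) * iexp (t \<bullet> y))"
  proof (rule Bochner_Integration.integral_cong[OF refl])
    fix t :: "real^'m"
    have "iexp (t \<bullet> y) = (\<Prod>b\<in>Basis. iexp ((t \<bullet> b) * (y \<bullet> b)))"
      unfolding euclidean_inner[of t y] by (simp add: exp_sum sum_distrib_left)
    then show "(\<Prod>b\<in>(Basis::(real^'m) set). f (t \<bullet> b) * iexp ((t \<bullet> b) * (y \<bullet> b))) =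
        of_real (\<Prod>b\<in>Basis. f (t \<bullet> b)) * iexp (t \<bullet> y)"
      by (simp add: prod.distrib)
  qed
  finally show ?thesis .
qed

text \<open>Fubini between frequencies and the probability space: the joint integrand has modulus
  \<open>\<bar>F t\<bar>\<close>, independent of the sample point and integrable in
  \<open>t\<close>. The shift by \<open>x\<^sub>0\<close> turns into a phase and the inner
  expectation into the characteristic function.\<close>

lemma expectation_prod_transform:
  fixes f g :: "real \<Rightarrow> real" and Z :: "'a \<Rightarrow> real^'m"
  assumes M: "prob_space M" and Z [measurable]: "Z \<in> borel_measurable M"
    and f: "integrable lborel f"
    and g: "\<And>x. (CLBINT s. f s * iexp (s * x)) = complex_of_real (g x)"
    and [measurable]: "g \<in> borel_measurable borel"
  shows "integrable M (\<lambda>\<omega>. \<Prod>b\<in>Basis. g ((Z \<omega> - x\<^sub>0) \<bullet> b))"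
    and "complex_of_real (LINT \<omega>|M. (\<Prod>b\<in>Basis. g ((Z \<omega> - x\<^sub>0) \<bullet> b))) =
      (CLINT t|lborel. of_real (\<Prod>b\<in>Basis. f (t \<bullet> b)) * iexp (- (t \<bullet> x\<^sub>0)) * char_vec M Z t)"
    and "integrable lborel (\<lambda>t. of_real (\<Prod>b\<in>Basis. f (t \<bullet> b)) * iexp (- (t \<bullet> x\<^sub>0)) * char_vec M Z t)"
proof -
  interpret prob_space M by fact
  interpret P: pair_sigma_finite "lborel :: (real^'m) measure" M ..
  have fm [measurable]: "f \<in> borel_measurable borel" using f by auto
  define F where "F t = (\<Prod>b\<in>Basis. f (t \<bullet> b))" for t :: "real^'m"
  have Fm [measurable]: "F \<in> borel_measurable borel" unfolding F_def[abs_def] by measurable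
  have Fi: "integrable lborel F" unfolding F_def[abs_def] by (rule integral_lborel_prod(1)[OF f])
  define h where "h = (\<lambda>t \<omega>. complex_of_real (F t) * iexp (t \<bullet> (Z \<omega> - x\<^sub>0)))"
  have hm [measurable]: "(\<lambda>(t, \<omega>). h t \<omega>) \<in> borel_measurable (lborel \<Otimes>\<^sub>M M)"
    unfolding h_def by measurable
  have hi: "integrable (lborel \<Otimes>\<^sub>M M) (\<lambda>(t, \<omega>). h t \<omega>)"
  proof (rule P.Fubini_integrable)
    have "(\<lambda>t. LINT \<omega>|M. norm (case (t, \<omega>) of (t, \<omega>) \<Rightarrow> h t \<omega>)) = (\<lambda>t. norm (F t))"
      by (auto simp: h_def norm_mult prob_space)
    then show "integrable lborel (\<lambda>t. LINT \<omega>|M. norm (case (t, \<omega>) of (t, \<omega>) \<Rightarrow> h t \<omega>))"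
      using Fi by simp
    show "AE t in lborel. integrable M (\<lambda>\<omega>. case (t, \<omega>) of (t, \<omega>) \<Rightarrow> h t \<omega>)"
      by (intro AE_I2 integrable_const_bound[where B="norm (F t)" for t])
         (auto simp: h_def norm_mult)
  qed simp
  have eq1: "(CLINT t|lborel. h t \<omega>) = of_real (\<Prod>b\<in>Basis. g ((Z \<omega> - x\<^sub>0) \<bullet> b))" for \<omega>
    using prod_transform_fourier[OF f g, of "Z \<omega> - x\<^sub>0"] by (simp only: h_def F_def)
  have eq2: "(CLINT \<omega>|M. h t \<omega>) = of_real (\<Prod>b\<in>Basis. f (t \<bullet> b)) * iexp (- (t \<bullet> x\<^sub>0)) * char_vec M Z t" for t
  proof -
    have "h t \<omega> = of_real (F t) * iexp (- (t \<bullet> x\<^sub>0)) * iexp (t \<bullet> Z \<omega>)" for \<omega>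
      by (simp add: h_def inner_diff_right right_diff_distrib exp_diff exp_minus divide_inverse)
    then show ?thesis
      by (simp only: char_vec_def F_def integral_mult_right_zero)
  qed
  have i1: "integrable M (\<lambda>\<omega>. complex_of_real (\<Prod>b\<in>Basis. g ((Z \<omega> - x\<^sub>0) \<bullet> b)))"
    using P.integrable_snd[OF hi] by (simp only: eq1)
  then show i2: "integrable M (\<lambda>\<omega>. \<Prod>b\<in>Basis. g ((Z \<omega> - x\<^sub>0) \<bullet> b))"
    by (simp only: complex_of_real_integrable_eq)
  show "integrable lborel (\<lambda>t. of_real (\<Prod>b\<in>Basis. f (t \<bullet> b)) * iexp (- (t \<bullet> x\<^sub>0)) * char_vec M Z t)"
    using P.integrable_fst[OF hi] by (simp only: eq2)
  show "complex_of_real (LINT \<omega>|M. (\<Prod>b\<in>Basis. g ((Z \<omega> - x\<^sub>0) \<bullet> b))) =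
      (CLINT t|lborel. of_real (\<Prod>b\<in>Basis. f (t \<bullet> b)) * iexp (- (t \<bullet> x\<^sub>0)) * char_vec M Z t)"
    using P.Fubini_integral[OF hi] unfolding eq1 eq2 by (simp only: integral_complex_of_real)
qed

section \<open>Box probabilities from characteristic functions on a cube\<close>

lemma smooth_step_measurable [measurable]: "smooth_step \<in> borel_measurable borel"
  unfolding smooth_step_def[abs_def] by measurable

lemma cusp_transform_measurable [measurable]: "cusp_transform \<in> borel_measurable borel"
  unfolding cusp_transform_def[abs_def] by measurable

lemma window_measurable [measurable]: "window T \<epsilon> \<in> borel_measurable borel"
  unfolding window_def[abs_def] by measurable

lemma window_error_measurable [measurable]: "window_error T \<epsilon> \<in> borel_measurable borel"
  unfolding window_error_def[abs_def] by measurable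

text \<open>When \<open>\<psi>\<close> is the characteristic function of a random vector, this is
  the expectation of the product of windows centered at \<open>x\<^sub>0\<close>. The kernel
  vanishes outside the cube of half-side \<open>T\<close>, so only the values of
  \<open>\<psi>\<close> there matter.\<close>

definition cube_integral :: "real \<Rightarrow> real \<Rightarrow> real^'m \<Rightarrow> (real^'m \<Rightarrow> complex) \<Rightarrow> complex" where
  "cube_integral T \<epsilon> x\<^sub>0 \<psi> =
    (CLINT t|lborel. of_real (\<Prod>b\<in>Basis. window_kernel T \<epsilon> (t \<bullet> b)) * iexp (- (t \<bullet> x\<^sub>0)) * \<psi> t)"

lemma infnorm_less_iff: "infnorm (x::real^'m) < \<epsilon> \<longleftrightarrow> (\<forall>b\<in>Basis. \<bar>x \<bullet> b\<bar> < \<epsilon>)"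
proof -
  have "{\<bar>x \<bullet> i\<bar> |i. i \<in> Basis} = (\<lambda>b. \<bar>x \<bullet> b\<bar>) ` Basis" by auto
  then have "infnorm x = Max ((\<lambda>b. \<bar>x \<bullet> b\<bar>) ` Basis)"
    unfolding infnorm_def by (simp add: cSup_eq_Max)
  then show ?thesis by (simp add: Max_less_iff)
qed

text \<open>Two errors are added. Replacing the indicator by the product of windows costs the
  expectation of a band-limited majorant, computed on the frequency side, where its weight is
  \<open>O(1 / T)\<close>. Replacing the characteristic function by \<open>\<psi>\<close> inside the
  cube then costs \<open>\<kappa>\<close> times the integral of \<open>G\<close>. The lower bound on
  \<open>T\<close> keeps \<open>K\<close> dependent on the dimension only.\<close>

lemma box_probability_approx:
  fixes Z :: "'a \<Rightarrow> real^'m" and \<psi> :: "real^'m \<Rightarrow> complex" and G :: "real^'m \<Rightarrow> real"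
  assumes M: "prob_space M" and Z [measurable]: "Z \<in> borel_measurable M"
    and T: "1 / CARD('m) \<le> T" and \<epsilon>: "0 < \<epsilon>" "\<epsilon> \<le> 1"
    and G: "integrable lborel G" "\<And>t. 0 \<le> G t"
    and \<psi> [measurable]: "\<psi> \<in> borel_measurable borel" and \<psi>G: "\<And>t. norm (\<psi> t) \<le> G t"
    and close: "\<And>t. (\<forall>b\<in>Basis. \<bar>t \<bullet> b\<bar> \<le> T) \<Longrightarrow> norm (char_vec M Z t - \<psi> t) \<le> \<kappa> * G t"
    and \<kappa>: "0 \<le> \<kappa>"
  defines "K \<equiv> real CARD('m) * (1 + 960 * real CARD('m)) ^ CARD('m) * 480"
  shows "\<bar>\<P>(\<omega> in M. infnorm (Z \<omega> - x\<^sub>0) < \<epsilon>) - Re (cube_integral T \<epsilon> x\<^sub>0 \<psi>)\<bar>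
    \<le> (\<kappa> + (\<kappa> + 1) * K / T) * (LINT t|lborel. G t)"
proof -
  interpret prob_space M by fact
  have T0: "T > 0" using T by (auto intro: less_le_trans[rotated])
  define k where "k c s = window_kernel T \<epsilon> s + c * window_error_kernel T \<epsilon> s" for c s
  define w where "w c x = window T \<epsilon> x + c * window_error T \<epsilon> x" for c x
  have [measurable]: "k c \<in> borel_measurable borel" "w c \<in> borel_measurable borel" for c
    unfolding k_def[abs_def] w_def[abs_def] by measurable
  have ki: "integrable lborel (k c)" for c
    unfolding k_def[abs_def] using kernels_integrable[OF T0 \<epsilon>] by auto
  have kw: "(CLBINT s. k c s * iexp (s * x)) = complex_of_real (w c x)" for c x
    unfolding k_def w_def by (rule window_sum_fourier[OF T0 \<epsilon>])
  define W where "W c \<omega> = (\<Prod>b\<in>Basis. w c ((Z \<omega> - x\<^sub>0) \<bullet> b))" for c \<omega>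
  define F where "F c t = (\<Prod>b\<in>Basis. k c (t \<bullet> b))" for c and t :: "real^'m"
  have Fm [measurable]: "F c \<in> borel_measurable borel" for c unfolding F_def[abs_def] by measurable
  note E = expectation_prod_transform[OF M Z ki kw, where x\<^sub>0=x\<^sub>0, folded F_def W_def]
  have Wi: "integrable M (W c)" for c using E(1) by (simp add: W_def[abs_def])
  define H where "H c t = of_real (F c t) * iexp (- (t \<bullet> x\<^sub>0)) * char_vec M Z t" for c t
  have Hi: "integrable lborel (H c)" for c using E(3) by (simp add: H_def[abs_def])
  have EW: "complex_of_real (LINT \<omega>|M. W c \<omega>) = (CLINT t|lborel. H c t)" for c
    using E(2) by (simp add: H_def)
  have cube: "norm (F c t) = 0" if out: "\<not> (\<forall>b\<in>Basis. \<bar>t \<bullet> b\<bar> \<le> T)" for c t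
  proof -
    obtain b where b: "b \<in> Basis" "\<not> \<bar>t \<bullet> b\<bar> \<le> T" using out by blast
    then have "t \<bullet> b \<notin> {-T..T}" by auto
    then have "k c (t \<bullet> b) = 0"
      using window_kernel_bound[OF T0 \<epsilon>, of "t \<bullet> b"] window_error_kernel_bound[OF T0, of \<epsilon> "t \<bullet> b"]
      by (simp add: k_def)
    then show ?thesis using b by (auto simp: F_def)
  qed
  have kb: "\<bar>window_kernel T \<epsilon> s\<bar> \<le> 1" "\<bar>window_error_kernel T \<epsilon> s\<bar> \<le> 480 / T" for s
    using window_kernel_bound[OF T0 \<epsilon>, of s] window_error_kernel_bound[OF T0, of \<epsilon> s] T0
    by (auto simp: indicator_def split: if_splits intro: order_trans)
  have T1: "480 / T \<le> 480 * CARD('m)" using T T0 by (simp add: field_simps)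
  have kb2: "\<bar>k c s\<bar> \<le> 1 + 960 * real CARD('m)" if "c = 1 \<or> c = 2" for c s
    using kb[of s] that T1 unfolding k_def by auto
  have F0: "norm (F 0 t) \<le> 1" for t
    unfolding F_def k_def using kb(1) by (auto simp: abs_prod intro!: prod_le_1)
  \<comment> \<open>Corresponding factors of \<open>F 2\<close> and \<open>F 1\<close> differ by one
    \<open>window_error_kernel\<close>, of size at most \<open>480 / T\<close>; this is where the
    saving of \<open>1 / T\<close> arises.\<close>
  have F12: "norm (F 2 t - F 1 t) \<le> K / T" for t
  proof -
    have "norm (F 2 t - F 1 t) \<le> real (card (Basis :: (real^'m) set)) * (1 + 960 * real CARD('m)) ^ card (Basis :: (real^'m) set) * (480 / T)"
      unfolding F_def
      by (rule norm_prod_diff_bound) (use kb2[of 1] kb2[of 2] kb(2) in \<open>auto simp: k_def algebra_simps\<close>)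
    then show ?thesis by (simp add: K_def)
  qed
  have phi: "norm (char_vec M Z t) \<le> (\<kappa> + 1) * G t" if "\<forall>b\<in>Basis. \<bar>t \<bullet> b\<bar> \<le> T" for t
    using norm_triangle_ineq[of "char_vec M Z t - \<psi> t" "\<psi> t"] close[OF that] \<psi>G[of t]
    by (simp add: algebra_simps)
  have ev: "{\<omega> \<in> space M. infnorm (Z \<omega> - x\<^sub>0) < \<epsilon>} \<in> sets M"
    unfolding infnorm_less_iff by measurable
  define I where "I \<omega> = (\<Prod>b\<in>Basis. indicator {x. \<bar>x\<bar> < \<epsilon>} ((Z \<omega> - x\<^sub>0) \<bullet> b) :: real)" for \<omega>
  have I: "I \<omega> = indicator {\<omega> \<in> space M. infnorm (Z \<omega> - x\<^sub>0) < \<epsilon>} \<omega>" if "\<omega> \<in> space M" for \<omega>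
    using that unfolding I_def infnorm_less_iff
    by (auto simp: indicator_def prod_eq_1_iff)
  have Ii: "integrable M I"
    by (subst Bochner_Integration.integrable_cong[OF refl I])
       (use ev in \<open>auto intro!: integrable_real_indicator simp: emeasure_eq_measure\<close>)
  have PI: "\<P>(\<omega> in M. infnorm (Z \<omega> - x\<^sub>0) < \<epsilon>) = (LINT \<omega>|M. I \<omega>)"
    by (subst Bochner_Integration.integral_cong[OF refl I]) (use ev in auto)
  have maj: "\<bar>W 0 \<omega> - I \<omega>\<bar> \<le> W 2 \<omega> - W 1 \<omega>" for \<omega>
  proof -
    have "\<bar>(\<Prod>b\<in>Basis. window T \<epsilon> ((Z \<omega> - x\<^sub>0) \<bullet> b)) - I \<omega>\<bar> \<le>
      (\<Prod>b\<in>Basis. window T \<epsilon> ((Z \<omega> - x\<^sub>0) \<bullet> b) + 2 * window_error T \<epsilon> ((Z \<omega> - x\<^sub>0) \<bullet> b)) -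
      (\<Prod>b\<in>Basis. window T \<epsilon> ((Z \<omega> - x\<^sub>0) \<bullet> b) + window_error T \<epsilon> ((Z \<omega> - x\<^sub>0) \<bullet> b))"
      unfolding I_def
      by (rule abs_prod_diff_le_majorant) (use window_approx[OF T0 \<epsilon>(1)] in auto)
    then show ?thesis by (simp add: W_def w_def)
  qed
  have "\<bar>(LINT \<omega>|M. W 0 \<omega>) - (LINT \<omega>|M. I \<omega>)\<bar> = \<bar>LINT \<omega>|M. W 0 \<omega> - I \<omega>\<bar>"
    using Wi Ii by (subst Bochner_Integration.integral_diff) auto
  also have "\<dots> \<le> (LINT \<omega>|M. \<bar>W 0 \<omega> - I \<omega>\<bar>)" by (rule integral_abs_bound)
  also have "\<dots> \<le> (LINT \<omega>|M. W 2 \<omega> - W 1 \<omega>)"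
    using Wi Ii maj by (intro integral_mono) auto
  \<comment> \<open>The majorant contains no absolute values, so its expectation is itself a Fourier
    integral over the cube, and a bound on the characteristic function there suffices.\<close>
  also have "\<dots> = Re (CLINT t|lborel. H 2 t - H 1 t)"
    using Wi Hi EW[of 1] EW[of 2]
    by (subst (1 2) Bochner_Integration.integral_diff) (auto simp flip: EW)
  also have "\<dots> \<le> (LINT t|lborel. norm (H 2 t - H 1 t))"
    by (rule order_trans[OF complex_Re_le_cmod integral_norm_bound])
  also have "\<dots> \<le> (LINT t|lborel. (\<kappa> + 1) * K / T * G t)"
  proof (rule integral_mono)
    show "norm (H 2 t - H 1 t) \<le> (\<kappa> + 1) * K / T * G t" for t
    proof -
      have "H 2 t - H 1 t = of_real (F 2 t - F 1 t) * (iexp (- (t \<bullet> x\<^sub>0)) * char_vec M Z t)"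
        by (simp add: H_def algebra_simps)
      then have n: "norm (H 2 t - H 1 t) = norm (F 2 t - F 1 t) * norm (char_vec M Z t)"
        by (simp only: norm_mult norm_of_real norm_exp_i_times real_norm_def mult_1)
      show ?thesis
      proof (cases "\<forall>b\<in>Basis. \<bar>t \<bullet> b\<bar> \<le> T")
        case True
        have "norm (H 2 t - H 1 t) \<le> K / T * ((\<kappa> + 1) * G t)"
          unfolding n using F12[of t] phi[OF True] T0 by (intro mult_mono) (auto simp: K_def)
        then show ?thesis by (simp add: mult_ac)
      next
        case False
        then show ?thesis unfolding n using cube[OF False] G(2)[of t] \<kappa> T0 by (simp add: K_def)
      qed
    qed
  qed (use Hi G in auto)
  finally have A: "\<bar>(LINT \<omega>|M. W 0 \<omega>) - (LINT \<omega>|M. I \<omega>)\<bar> \<le> (\<kappa> + 1) * K / T * (LINT t|lborel. G t)"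
    by simp
  define J where "J t = of_real (F 0 t) * iexp (- (t \<bullet> x\<^sub>0)) * \<psi> t" for t
  have Jm: "J \<in> borel_measurable borel" unfolding J_def[abs_def] by measurable
  have Ji: "integrable lborel J"
  proof (rule Bochner_Integration.integrable_bound[OF G(1)])
    show "AE t in lborel. norm (J t) \<le> norm (G t)"
    proof (rule AE_I2)
      fix t
      have "norm (J t) = norm (F 0 t) * norm (\<psi> t)"
        by (simp only: J_def norm_mult norm_of_real norm_exp_i_times real_norm_def mult_1 mult.right_neutral)
      also have "\<dots> \<le> 1 * G t" using F0 \<psi>G by (intro mult_mono) auto
      finally show "norm (J t) \<le> norm (G t)" by simp
    qed
  qed (use Jm in simp)
  have cI: "cube_integral T \<epsilon> x\<^sub>0 \<psi> = (CLINT t|lborel. J t)"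
    by (simp add: cube_integral_def J_def F_def k_def)
  \<comment> \<open>The second error: the same kernel \<open>F 0\<close>, bounded by 1, is
    integrated against the difference of the characteristic function and
    \<open>\<psi>\<close>.\<close>
  have "\<bar>(LINT \<omega>|M. W 0 \<omega>) - Re (cube_integral T \<epsilon> x\<^sub>0 \<psi>)\<bar> = \<bar>Re (CLINT t|lborel. H 0 t - J t)\<bar>"
    using Hi Ji by (subst Bochner_Integration.integral_diff) (auto simp: cI simp flip: EW)
  also have "\<dots> \<le> (LINT t|lborel. norm (H 0 t - J t))"
    by (rule order_trans[OF abs_Re_le_cmod integral_norm_bound])
  also have "\<dots> \<le> (LINT t|lborel. \<kappa> * G t)"
  proof (rule integral_mono)
    show "norm (H 0 t - J t) \<le> \<kappa> * G t" for t
    proof -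
      have "H 0 t - J t = of_real (F 0 t) * (iexp (- (t \<bullet> x\<^sub>0)) * (char_vec M Z t - \<psi> t))"
        by (simp add: H_def J_def algebra_simps)
      then have n: "norm (H 0 t - J t) = norm (F 0 t) * norm (char_vec M Z t - \<psi> t)"
        by (simp only: norm_mult norm_of_real norm_exp_i_times real_norm_def mult_1)
      show ?thesis
      proof (cases "\<forall>b\<in>Basis. \<bar>t \<bullet> b\<bar> \<le> T")
        case True
        have "norm (H 0 t - J t) \<le> 1 * (\<kappa> * G t)"
          unfolding n using F0[of t] close[OF True] by (intro mult_mono) auto
        then show ?thesis by simp
      next
        case False
        then show ?thesis unfolding n using cube[OF False] G(2)[of t] \<kappa> by simp
      qed
    qed
  qed (use Hi Ji G in auto)
  finally have B: "\<bar>(LINT \<omega>|M. W 0 \<omega>) - Re (cube_integral T \<epsilon> x\<^sub>0 \<psi>)\<bar> \<le> \<kappa> * (LINT t|lborel. G t)"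
    by simp
  show ?thesis unfolding PI using A B by (simp add: distrib_right)
qed

section \<open>Gaussian integrals\<close>

lemma nn_integral_lborel_uminus:
  fixes h :: "'a::euclidean_space \<Rightarrow> ennreal"
  assumes [measurable]: "h \<in> borel_measurable borel"
  shows "(\<integral>\<^sup>+x. h (- x) \<partial>lborel) = (\<integral>\<^sup>+x. h x \<partial>lborel)"
proof -
  have "(\<integral>\<^sup>+x. h x \<partial>lborel) = (\<integral>\<^sup>+x. h x \<partial>distr lborel borel (\<lambda>x. - x))"
    by (subst lborel_affine[of "-1" 0]) (auto simp: density_1 one_ennreal_def[symmetric])
  then show ?thesis by (simp add: nn_integral_distr)
qed

lemma nn_integral_lborel_translate:
  fixes h :: "'a::euclidean_space \<Rightarrow> ennreal"
  assumes [measurable]: "h \<in> borel_measurable borel"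
  shows "(\<integral>\<^sup>+x. h (c + x) \<partial>lborel) = (\<integral>\<^sup>+x. h x \<partial>lborel)"
proof -
  have "(\<integral>\<^sup>+x. h x \<partial>lborel) = (\<integral>\<^sup>+x. h x \<partial>distr lborel borel ((+) c))"
    by (simp only: lborel_distr_plus)
  then show ?thesis by (simp add: nn_integral_distr)
qed

text \<open>Uniqueness of Haar measure: both sides are translation invariant in \<open>g\<close>, and the unit
  ball, which \<open>L\<close> preserves, fixes the normalization.\<close>

lemma nn_integral_lborel_orthogonal:
  fixes g :: "'a::euclidean_space \<Rightarrow> ennreal" and L :: "'a \<Rightarrow> 'a"
  assumes L: "orthogonal_transformation L" and g [measurable]: "g \<in> borel_measurable borel"
  shows "(\<integral>\<^sup>+x. g (L x) \<partial>lborel) = (\<integral>\<^sup>+x. g x \<partial>lborel)"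
proof -
  have lin: "linear L" using L by (rule orthogonal_transformation_linear)
  have Lm [measurable]: "L \<in> borel_measurable borel"
    using lin unfolding linear_conv_bounded_linear
    by (intro borel_measurable_continuous_onI linear_continuous_on)
  define f :: "'a \<Rightarrow> ennreal" where "f = indicator (ball 0 1)"
  have [measurable]: "f \<in> borel_measurable borel" unfolding f_def by (intro borel_measurable_indicator) auto
  have fL: "f (L x) = f x" "f (- x) = f x" for x :: 'a
    using orthogonal_transformation_norm[OF L] by (auto simp: f_def indicator_def)
  define c where "c = (\<integral>\<^sup>+x. f x \<partial>lborel)"
  have c: "c \<noteq> 0" "c \<noteq> \<infinity>"
  proof -
    have ceq: "c = emeasure lborel (ball (0::'a) 1)"
      unfolding c_def f_def by (rule nn_integral_indicator) simp
    show "c \<noteq> \<infinity>" using emeasure_lborel_ball_finite[of "0::'a" 1] by (simp add: ceq)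
    show "c \<noteq> 0" using content_ball_pos[of 1 "0::'a"] by (auto simp: ceq measure_def)
  qed
  obtain L' where L': "\<And>x. L (L' x) = x" using orthogonal_transformation_surj[OF L] by (metis surjD)
  \<comment> \<open>The double integral of \<open>f x * g (x + L y)\<close> is evaluated in two
    orders. Integrating over \<open>y\<close> first, \<open>x\<close> is written as
    \<open>L (L' x)\<close> and absorbed by translating \<open>y\<close>, which leaves
    \<open>c\<close> times the integral of \<open>g\<close> composed with \<open>L\<close>.\<close>
  have "c * (\<integral>\<^sup>+y. g (L y) \<partial>lborel) = (\<integral>\<^sup>+x. f x * (\<integral>\<^sup>+y. g (L (L' x + y)) \<partial>lborel) \<partial>lborel)"
  proof -
    have "(\<integral>\<^sup>+y. g (L (L' x + y)) \<partial>lborel) = (\<integral>\<^sup>+y. g (L y) \<partial>lborel)" for x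
      by (rule nn_integral_lborel_translate[of "\<lambda>y. g (L y)"]) measurable
    then show ?thesis by (simp only: c_def) (rule nn_integral_multc[symmetric], measurable)
  qed
  also have "\<dots> = (\<integral>\<^sup>+x. \<integral>\<^sup>+y. f x * g (x + L y) \<partial>lborel \<partial>lborel)"
    unfolding linear_add[OF lin] L' by (intro nn_integral_cong nn_integral_cmult[symmetric]) measurable
  also have "\<dots> = (\<integral>\<^sup>+y. \<integral>\<^sup>+x. f x * g (x + L y) \<partial>lborel \<partial>lborel)"
    by (rule lborel_pair.Fubini'[symmetric]) measurable
  also have "\<dots> = (\<integral>\<^sup>+y. \<integral>\<^sup>+x. f (- L y + x) * g x \<partial>lborel \<partial>lborel)"
  proof (rule nn_integral_cong)
    fix y
    show "(\<integral>\<^sup>+x. f x * g (x + L y) \<partial>lborel) = (\<integral>\<^sup>+x. f (- L y + x) * g x \<partial>lborel)"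
      using nn_integral_lborel_translate[of "\<lambda>x. f x * g (x + L y)" "- L y"] by simp
  qed
  also have "\<dots> = (\<integral>\<^sup>+x. \<integral>\<^sup>+y. f (- L y + x) * g x \<partial>lborel \<partial>lborel)"
    by (rule lborel_pair.Fubini') measurable
  \<comment> \<open>Now \<open>f\<close>, the indicator of the unit ball, carries the map
    \<open>L\<close> and does not see it; reflection and translation invariance reduce the inner
    integral to \<open>c\<close>.\<close>
  also have "\<dots> = (\<integral>\<^sup>+x. (\<integral>\<^sup>+y. f (L (L' x + - y)) \<partial>lborel) * g x \<partial>lborel)"
  proof (rule nn_integral_cong)
    fix x
    have "L (L' x + - y) = - L y + x" for y
      by (simp only: linear_add[OF lin] linear_neg[OF lin] L' add.commute)
    then show "(\<integral>\<^sup>+y. f (- L y + x) * g x \<partial>lborel) = (\<integral>\<^sup>+y. f (L (L' x + - y)) \<partial>lborel) * g x"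
      by (simp only:) (rule nn_integral_multc, measurable)
  qed
  also have "\<dots> = (\<integral>\<^sup>+x. c * g x \<partial>lborel)"
  proof -
    have "(\<integral>\<^sup>+y. f (L' x + - y) \<partial>lborel) = (\<integral>\<^sup>+y. f (L' x + y) \<partial>lborel)" for x
      by (rule nn_integral_lborel_uminus[of "\<lambda>y. f (L' x + y)"]) measurable
    moreover have "(\<integral>\<^sup>+y. f (L' x + y) \<partial>lborel) = c" for x
      unfolding c_def by (rule nn_integral_lborel_translate) measurable
    ultimately show ?thesis by (simp only: fL)
  qed
  also have "\<dots> = c * (\<integral>\<^sup>+x. g x \<partial>lborel)" by (simp add: nn_integral_cmult)
  finally show ?thesis using c by (simp only: ennreal_mult_cancel_left) simp
qed

section \<open>One-dimensional Gaussian integrals and diagonalization of the quadratic form\<close>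

lemma gaussian_integral_1d:
  fixes c :: real
  assumes "c > 0"
  shows "(\<integral>\<^sup>+s. ennreal (exp (- c * s\<^sup>2)) \<partial>lborel) = ennreal (sqrt (pi / c))"
proof -
  define \<sigma> where "\<sigma> = sqrt (1 / (2 * c))"
  have s: "\<sigma> > 0" "\<sigma>\<^sup>2 = 1 / (2 * c)" using assms by (auto simp: \<sigma>_def)
  have e: "exp (- c * x\<^sup>2) = sqrt (pi / c) * normal_density 0 \<sigma> x" for x
  proof -
    have "2 * pi * \<sigma>\<^sup>2 = pi / c" "x\<^sup>2 / (2 * \<sigma>\<^sup>2) = c * x\<^sup>2" using assms by (auto simp: s field_simps)
    then show ?thesis using assms by (simp add: normal_density_def)
  qed
  have "(\<integral>\<^sup>+s. ennreal (exp (- c * s\<^sup>2)) \<partial>lborel) = (\<integral>\<^sup>+s. ennreal (sqrt (pi / c)) * ennreal (normal_density 0 \<sigma> s) \<partial>lborel)"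
    unfolding e using s assms by (intro nn_integral_cong) (simp add: ennreal_mult')
  also have "\<dots> = ennreal (sqrt (pi / c)) * (\<integral>\<^sup>+s. ennreal (normal_density 0 \<sigma> s) \<partial>lborel)"
    by (rule nn_integral_cmult) simp
  also have "(\<integral>\<^sup>+s. ennreal (normal_density 0 \<sigma> s) \<partial>lborel) = 1"
    using s integral_normal_density[of \<sigma> 0] integrable_normal_density[of \<sigma> 0]
    by (subst nn_integral_eq_integral) auto
  finally show ?thesis by simp
qed

lemma sqrt_prod: "sqrt (prod f A) = (\<Prod>x\<in>A. sqrt (f x))"
  by (induction A rule: infinite_finite_induct) (auto simp: real_sqrt_mult)

lemma eigenvalue_list_diagonalize:
  fixes q :: "real^'m \<Rightarrow> real"
  assumes q: "eigenvalue_list q ds"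
  obtains L :: "real^'m \<Rightarrow> real^'m" and e :: "real^'m \<Rightarrow> nat"
  where "orthogonal_transformation L" "bij_betw e Basis {..<CARD('m)}"
    "\<And>y. q (L y) = (\<Sum>b\<in>Basis. ds ! e b * (y \<bullet> b)\<^sup>2)"
proof -
  let ?n = "CARD('m)"
  obtain v :: "nat \<Rightarrow> real^'m" where len: "length ds = ?n"
    and v: "\<And>i j. i < ?n \<Longrightarrow> j < ?n \<Longrightarrow> v i \<bullet> v j = (if i = j then 1 else 0)"
    and qv: "\<And>t. q t = (\<Sum>i<?n. ds ! i * (v i \<bullet> t)\<^sup>2)"
    using q unfolding eigenvalue_list_def by blast
  obtain e :: "real^'m \<Rightarrow> nat" where e: "bij_betw e Basis {..<?n}"
    using ex_bij_betw_finite_nat[of "Basis :: (real^'m) set"] by (auto simp: atLeast0LessThan)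
  have en: "e b < ?n" if "b \<in> Basis" for b using e that by (auto simp: bij_betw_def)
  have einj: "e b = e b' \<longleftrightarrow> b = b'" if "b \<in> Basis" "b' \<in> Basis" for b b'
    using e that by (auto simp: bij_betw_def inj_on_def)
  \<comment> \<open>\<open>L\<close> sends the standard basis to the eigenvectors through the
    enumeration \<open>e\<close>, so orthonormality of the eigenvectors makes it orthogonal, and
    \<open>q\<close> becomes diagonal after composition with it.\<close>
  define L :: "real^'m \<Rightarrow> real^'m" where "L y = (\<Sum>b\<in>Basis. (y \<bullet> b) *\<^sub>R v (e b))" for y
  have vL: "v (e b) \<bullet> L y = y \<bullet> b" if "b \<in> Basis" for b y
    using that by (simp add: L_def inner_sum_right v en einj if_distrib[where f="\<lambda>x. _ * x"] cong: if_cong)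
  have L: "orthogonal_transformation L"
    unfolding orthogonal_transformation_def
  proof (intro conjI allI)
    show "linear L" by (rule linearI) (simp_all add: L_def inner_add_left algebra_simps sum.distrib scaleR_sum_right)
    show "L x \<bullet> L y = x \<bullet> y" for x y
      unfolding L_def[of x] by (simp add: inner_sum_left vL euclidean_inner[of x y])
  qed
  have qL: "q (L y) = (\<Sum>b\<in>Basis. ds ! e b * (y \<bullet> b)\<^sup>2)" for y
    unfolding qv by (subst sum.reindex_bij_betw[OF e, symmetric]) (simp add: vL)
  show ?thesis by (rule that[OF L e qL])
qed

lemma eigenvalue_list_measurable:
  "eigenvalue_list q ds \<Longrightarrow> q \<in> borel_measurable borel"
proof -
  assume "eigenvalue_list q ds"
  then obtain v where "\<And>t. q t = (\<Sum>i<CARD('a). ds ! i * (v i \<bullet> t)\<^sup>2)"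
    unfolding eigenvalue_list_def by blast
  then have "q = (\<lambda>t. \<Sum>i<CARD('a). ds ! i * (v i \<bullet> t)\<^sup>2)" by auto
  then show ?thesis by simp
qed

lemma eigenvalue_list_zero: "eigenvalue_list q ds \<Longrightarrow> q 0 = 0"
  unfolding eigenvalue_list_def by (elim conjE exE) simp

lemma eigenvalue_list_ge_hd:
  fixes q :: "real^'m \<Rightarrow> real"
  assumes q: "eigenvalue_list q ds"
  shows "hd ds * (norm t)\<^sup>2 \<le> q t"
proof -
  obtain L :: "real^'m \<Rightarrow> real^'m" and e :: "real^'m \<Rightarrow> nat" where L: "orthogonal_transformation L" and e: "bij_betw e Basis {..<CARD('m)}"
    and qL: "\<And>y. q (L y) = (\<Sum>b\<in>Basis. ds ! e b * (y \<bullet> b)\<^sup>2)"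
    by (rule eigenvalue_list_diagonalize[OF q]) blast
  have len: "length ds = CARD('m)" and sorted: "sorted ds" using q unfolding eigenvalue_list_def by blast+
  obtain y where y: "t = L y" using orthogonal_transformation_surj[OF L] by (metis surjD)
  have "norm t = norm y" using orthogonal_transformation_norm[OF L] y by simp
  then have "hd ds * (norm t)\<^sup>2 = hd ds * (\<Sum>b\<in>Basis. (y \<bullet> b)\<^sup>2)"
    using euclidean_inner[of y y] by (simp add: power2_norm_eq_inner flip: power2_eq_square)
  also have "\<dots> = (\<Sum>b\<in>Basis. hd ds * (y \<bullet> b)\<^sup>2)" by (rule sum_distrib_left)
  also have "\<dots> \<le> (\<Sum>b\<in>Basis. ds ! e b * (y \<bullet> b)\<^sup>2)"
  proof (intro sum_mono mult_right_mono)
    fix b :: "real^'m" assume "b \<in> Basis"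
    then have "e b < length ds" using e len by (auto simp: bij_betw_def)
    then show "hd ds \<le> ds ! e b" using sorted_nth_mono[OF sorted, of 0 "e b"] by (cases ds) auto
  qed simp
  also have "\<dots> = q t" by (simp add: y qL)
  finally show ?thesis .
qed

text \<open>Each eigenvalue is the value of \<open>q\<close> at its own unit eigenvector.\<close>

lemma eigenvalues_nonneg:
  fixes q :: "real^'m \<Rightarrow> real"
  assumes q: "eigenvalue_list q ds" and nn: "\<And>t. 0 \<le> q t" and d: "d \<in> set ds"
  shows "0 \<le> d"
proof -
  obtain v :: "nat \<Rightarrow> real^'m" where len: "length ds = CARD('m)"
    and v: "\<And>i j. i < CARD('m) \<Longrightarrow> j < CARD('m) \<Longrightarrow> v i \<bullet> v j = (if i = j then 1 else 0)"
    and qv: "\<And>t. q t = (\<Sum>i<CARD('m). ds ! i * (v i \<bullet> t)\<^sup>2)"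
    using q unfolding eigenvalue_list_def by blast
  obtain i where i: "i < CARD('m)" "d = ds ! i" using d len by (auto simp: in_set_conv_nth)
  have "q (v i) = (\<Sum>j<CARD('m). if j = i then ds ! j else 0)"
    unfolding qv using v i by (intro sum.cong) auto
  then show ?thesis using nn[of "v i"] i by simp
qed

text \<open>In eigenvector coordinates the integrand is a product of one-dimensional Gaussians, and
  the product of their integrals produces the factor \<open>1 / sqrt (prod_list ds)\<close>.\<close>

lemma gaussian_integral:
  fixes q :: "real^'m \<Rightarrow> real"
  assumes q: "eigenvalue_list q ds" and pos: "\<And>d. d \<in> set ds \<Longrightarrow> 0 < d" and c: "c > 0"
  shows "integrable lborel (\<lambda>t. exp (- (q t * c)))"
    and "(LINT t|lborel. exp (- (q t * c))) = sqrt (pi / c) ^ CARD('m) / sqrt (prod_list ds)"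
proof -
  let ?n = "CARD('m)"
  obtain L :: "real^'m \<Rightarrow> real^'m" and e :: "real^'m \<Rightarrow> nat" where L: "orthogonal_transformation L" and e: "bij_betw e Basis {..<?n}"
    and qL: "\<And>y. q (L y) = (\<Sum>b\<in>Basis. ds ! e b * (y \<bullet> b)\<^sup>2)"
    by (rule eigenvalue_list_diagonalize[OF q]) blast
  have len: "length ds = ?n" using q unfolding eigenvalue_list_def by blast
  have en: "e b < ?n" if "b \<in> Basis" for b using e that by (auto simp: bij_betw_def)
  note [measurable] = eigenvalue_list_measurable[OF q]
  have dpos: "ds ! i > 0" if "i < ?n" for i using that pos len by auto
  have prodd: "(\<Prod>b\<in>(Basis::(real^'m) set). ds ! e b) = prod_list ds"
    using prod.reindex_bij_betw[OF e, of "\<lambda>i. ds ! i"] len by (simp add: prod.list_conv_set_nth atLeast0LessThan)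
  have "(\<integral>\<^sup>+t. ennreal (exp (- (q t * c))) \<partial>lborel) = (\<integral>\<^sup>+y. ennreal (exp (- (q (L y) * c))) \<partial>lborel)"
    by (rule nn_integral_lborel_orthogonal[OF L, symmetric]) measurable
  also have "\<dots> = (\<integral>\<^sup>+y. (\<Prod>b\<in>(Basis::(real^'m) set). ennreal (exp (- (ds ! e b * c) * (y \<bullet> b)\<^sup>2))) \<partial>lborel)"
    by (intro nn_integral_cong)
       (simp add: prod_ennreal qL sum_distrib_right flip: exp_sum sum_negf, simp add: mult_ac)
  also have "\<dots> = (\<Prod>b\<in>(Basis::(real^'m) set). (\<integral>\<^sup>+s. ennreal (exp (- (ds ! e b * c) * s\<^sup>2)) \<partial>lborel))"
    by (rule nn_integral_lborel_prod) auto
  also have "\<dots> = (\<Prod>b\<in>(Basis::(real^'m) set). ennreal (sqrt (pi / (ds ! e b * c))))"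
    using dpos en c by (intro prod.cong refl gaussian_integral_1d) simp
  also have "\<dots> = ennreal (\<Prod>b\<in>(Basis::(real^'m) set). sqrt (pi / c) / sqrt (ds ! e b))"
    using dpos en c by (subst prod_ennreal) (auto simp: real_sqrt_divide real_sqrt_mult less_imp_le mult_ac)
  also have "(\<Prod>b\<in>(Basis::(real^'m) set). sqrt (pi / c) / sqrt (ds ! e b)) = sqrt (pi / c) ^ ?n / sqrt (prod_list ds)"
    by (simp add: prod_dividef prodd[symmetric] sqrt_prod)
  finally have nn: "(\<integral>\<^sup>+t. ennreal (exp (- (q t * c))) \<partial>lborel) = ennreal (sqrt (pi / c) ^ ?n / sqrt (prod_list ds))" .
  have "prod_list ds \<ge> 0" using pos by (induction ds) (auto simp: less_imp_le)
  then have n0: "0 \<le> sqrt (pi / c) ^ ?n / sqrt (prod_list ds)" using c by simp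
  show i: "integrable lborel (\<lambda>t. exp (- (q t * c)))"
    by (rule integrableI_nn_integral_finite[OF _ _ nn]) (use n0 in auto)
  show "(LINT t|lborel. exp (- (q t * c))) = sqrt (pi / c) ^ ?n / sqrt (prod_list ds)"
    using nn n0 by (subst integral_eq_nn_integral) auto
qed

section \<open>Comparison of characteristic functions\<close>

text \<open>A product of at least 1 forces the largest eigenvalue to be at least 1, and the balance
  condition passes this on to the smallest. All eigenvalues are then at least 1, so the product
  dominates the smallest one, while it is at most the \<open>m\<close>-th power of the
  largest.\<close>

lemma balanced_eigenvalues:
  fixes q :: "real^'m \<Rightarrow> real"
  assumes q: "nonneg_quadratic_form q" "eigenvalue_list q ds"
    and \<mu>: "0 < \<mu>" "last ds \<le> hd ds powr \<mu>" and \<sigma>: "1 \<le> prod_list ds"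
  shows "1 \<le> hd ds" "\<And>d. d \<in> set ds \<Longrightarrow> 0 < d"
    "prod_list ds \<le> hd ds powr (\<mu> * CARD('m))" "hd ds \<le> prod_list ds"
proof -
  have len: "length ds = CARD('m)" and sorted: "sorted ds"
    using q(2) unfolding eigenvalue_list_def by blast+
  have ne: "ds \<noteq> []" using len by auto
  have nn: "0 \<le> d" if "d \<in> set ds" for d
    using eigenvalues_nonneg[OF q(2) _ that] q(1) by (auto simp: nonneg_quadratic_form_def)
  have le_last: "d \<le> last ds" if d: "d \<in> set ds" for d
  proof -
    obtain i where "i < length ds" "d = ds ! i" using d by (auto simp: in_set_conv_nth)
    then show ?thesis
      using sorted_nth_mono[OF sorted, of i "length ds - 1"] by (simp add: last_conv_nth[OF ne])
  qed
  have ge_hd: "hd ds \<le> d" if "d \<in> set ds" for d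
    using sorted that by (cases ds) auto
  have "prod_list xs \<le> z ^ length xs" if "\<forall>d\<in>set xs. 0 \<le> d \<and> d \<le> z" for xs and z :: real
    using that
  proof (induction xs)
    case (Cons x xs)
    then have "prod_list (x # xs) \<le> z * z ^ length xs"
      by (auto intro!: mult_mono prod_list_nonneg)
    then show ?case by simp
  qed simp
  then have pl: "prod_list ds \<le> last ds ^ CARD('m)" using nn le_last len by metis
  have l0: "0 \<le> last ds" using nn ne by simp
  have last1: "1 \<le> last ds"
  proof (rule ccontr)
    assume "\<not> 1 \<le> last ds"
    then have "last ds ^ CARD('m) < 1" using l0 by (intro power_less_one_iff[THEN iffD2]) auto
    then show False using pl \<sigma> by simp
  qed
  show hd1: "1 \<le> hd ds"
  proof (rule ccontr)
    assume "\<not> 1 \<le> hd ds"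
    moreover have "0 \<le> hd ds" using nn ne by simp
    ultimately have "hd ds powr \<mu> < 1"
      using \<mu>(1) powr_less_mono2[of \<mu> "hd ds" 1] by simp
    then show False using \<mu>(2) last1 by simp
  qed
  show "0 < d" if "d \<in> set ds" for d using ge_hd[OF that] hd1 by simp
  have "prod_list ds \<le> (hd ds powr \<mu>) ^ CARD('m)"
    using pl power_mono[OF \<mu>(2) l0, of "CARD('m)"] by linarith
  also have "\<dots> = hd ds powr (\<mu> * CARD('m))"
    by (subst powr_realpow[symmetric]) (use hd1 in \<open>auto simp: powr_powr\<close>)
  finally show "prod_list ds \<le> hd ds powr (\<mu> * CARD('m))" .
  obtain d ds' where ds: "ds = d # ds'" using ne by (cases ds) auto
  have "1 \<le> prod_list xs" if "\<forall>d\<in>set xs. 1 \<le> d" for xs :: "real list"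
    using that by (induction xs) (auto simp: mult_ge1_I)
  moreover have "\<forall>d\<in>set ds'. 1 \<le> d" using ge_hd hd1 ds by fastforce
  ultimately have "1 \<le> prod_list ds'" by blast
  then show "hd ds \<le> prod_list ds" using hd1 ds by simp
qed

text \<open>Half of the Gaussian exponent is given up to absorb the factor \<open>norm t\<close> and
  gain \<open>1 / sqrt d\<close>, by
  \<open>x \<le> 1 + x\<^sup>2 / 4 \<le> exp (x\<^sup>2 / 4)\<close> with
  \<open>x = sqrt d * norm t\<close>. It converts Lipschitz bounds at the origin into a
  saving.\<close>

lemma gaussian_linear_bound:
  fixes q :: real and t :: "'a::real_normed_vector"
  assumes "1 \<le> d" "d * (norm t)\<^sup>2 \<le> q"
  shows "norm t * exp (- q / 2) \<le> exp (- q / 4) / sqrt d"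
proof -
  define x where "x = sqrt d * norm t"
  have "0 \<le> (x - 2)\<^sup>2" by simp
  then have "x \<le> 1 + x\<^sup>2 / 4" by (simp add: power2_eq_square algebra_simps)
  also have "\<dots> \<le> exp (x\<^sup>2 / 4)" by (rule exp_ge_add_one_self)
  also have "x\<^sup>2 = d * (norm t)\<^sup>2" using assms by (simp add: x_def power_mult_distrib)
  also have "exp (d * (norm t)\<^sup>2 / 4) \<le> exp (q / 4)" using assms by simp
  finally have "norm t * sqrt d \<le> exp (q / 4)" by (simp add: x_def mult.commute)
  then have "norm t \<le> exp (q / 4) / sqrt d" using assms by (simp add: field_simps)
  then have "norm t * exp (- q / 2) \<le> exp (q / 4) / sqrt d * exp (- q / 2)"
    by (intro mult_right_mono) auto
  also have "\<dots> = exp (- q / 4) / sqrt d"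
    by (simp flip: exp_add)
  finally show ?thesis .
qed

text \<open>The derivative is continuous on the open ball of radius 2, hence bounded on the compact
  unit ball, and the mean value inequality applies on that convex set.\<close>

lemma C1_lipschitz_at_0:
  fixes \<Phi> :: "'a::euclidean_space \<Rightarrow> 'b::real_normed_vector"
  assumes "C1_on \<Phi> {t. norm t < 2}"
  obtains L where "0 \<le> L" "\<And>t. norm t \<le> 1 \<Longrightarrow> norm (\<Phi> t - \<Phi> 0) \<le> L * norm t"
proof -
  obtain f' :: "'a \<Rightarrow> 'a \<Rightarrow>\<^sub>L 'b" where f': "\<And>x. norm x < 2 \<Longrightarrow> (\<Phi> has_derivative blinfun_apply (f' x)) (at x)"
    and c: "continuous_on {t. norm t < 2} f'"
    using assms unfolding C1_on_def by auto
  have "continuous_on (cball 0 1) (\<lambda>x. norm (f' x))"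
    by (intro continuous_on_norm continuous_on_subset[OF c]) auto
  then have "compact ((\<lambda>x. norm (f' x)) ` cball 0 1)"
    by (rule compact_continuous_image) simp
  from compact_imp_bounded[OF this] obtain L where L': "\<forall>x\<in>cball 0 1. norm (norm (f' x)) \<le> L"
    unfolding bounded_iff by (auto simp only: ball_simps image_iff bex_simps)
  have L: "norm (f' x) \<le> L" if "x \<in> cball 0 1" for x
    using L'[rule_format, OF that] by simp
  have "norm (f' 0) \<le> L" using L[of 0] by simp
  then have "0 \<le> L" using norm_ge_zero[of "f' 0"] by linarith
  moreover have "norm (\<Phi> t - \<Phi> 0) \<le> L * norm t" if "norm t \<le> 1" for t
  proof -
    have "norm (\<Phi> t - \<Phi> 0) \<le> L * norm (t - 0)"
    proof (rule differentiable_bound[of "cball 0 1" \<Phi> "\<lambda>x. blinfun_apply (f' x)"])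
      show "(\<Phi> has_derivative blinfun_apply (f' x)) (at x within cball 0 1)" if "x \<in> cball 0 1" for x
      proof (rule has_derivative_at_withinI[OF f'])
        show "norm x < 2" using that by simp
      qed
      show "onorm (blinfun_apply (f' x)) \<le> L" if "x \<in> cball 0 1" for x
        using L[OF that] by (simp only: norm_blinfun.rep_eq)
      show "t \<in> cball 0 1" using \<open>norm t \<le> 1\<close> by simp
    qed simp_all
    then show ?thesis by simp
  qed
  ultimately show ?thesis by (rule that)
qed

text \<open>After \<open>r \<le> exp r\<close>, complete the square in the exponent.\<close>

lemma exp_quadratic_bound:
  fixes r \<beta> :: real
  assumes "0 \<le> r" "0 \<le> \<beta>"
  shows "r * exp (\<beta> * r - r\<^sup>2 / 4) \<le> exp ((\<beta> + 1)\<^sup>2)"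
proof -
  have "r \<le> exp r" using exp_ge_add_one_self[of r] by linarith
  then have "r * exp (\<beta> * r - r\<^sup>2 / 4) \<le> exp r * exp (\<beta> * r - r\<^sup>2 / 4)"
    by (intro mult_right_mono) auto
  also have "\<dots> = exp ((\<beta> + 1)\<^sup>2 - (r / 2 - (\<beta> + 1))\<^sup>2)"
    by (simp add: power2_eq_square field_simps flip: exp_add)
  also have "\<dots> \<le> exp ((\<beta> + 1)\<^sup>2)" by simp
  finally show ?thesis .
qed

text \<open>With \<open>z = w ^ 4\<close> a cubic competes with a quartic: beyond
  \<open>w = 2 * \<beta> / \<alpha>\<close> the cubic is at most half of the quartic, and below that
  point it is at most its value there. The remaining half absorbs the factor \<open>z\<close>
  through \<open>x * exp (- x) \<le> 1\<close>.\<close>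

lemma exp_three_quarter_bound:
  fixes z \<alpha> \<beta> :: real
  assumes "1 \<le> z" "0 < \<alpha>" "0 \<le> \<beta>"
  shows "z * exp (\<beta> * z powr (3/4) - \<alpha> * z) \<le> 2 / \<alpha> * exp (\<beta> * (2 * \<beta> / \<alpha>) ^ 3)"
proof -
  define w where "w = z powr (1/4)"
  have w0: "0 \<le> w" by (simp add: w_def)
  have w3: "z powr (3/4) = w ^ 3" and w4: "z = w ^ 4"
    using assms by (simp_all add: w_def powr_powr flip: powr_realpow)
  have "\<beta> * w ^ 3 - \<alpha> * w ^ 4 \<le> \<beta> * (2 * \<beta> / \<alpha>) ^ 3 - \<alpha> / 2 * w ^ 4"
  proof (cases "w \<le> 2 * \<beta> / \<alpha>")
    case True
    have "\<beta> * w ^ 3 \<le> \<beta> * (2 * \<beta> / \<alpha>) ^ 3"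
      using True w0 assms by (intro mult_left_mono power_mono) auto
    moreover have "\<alpha> / 2 * w ^ 4 \<le> \<alpha> * w ^ 4" using assms by simp
    ultimately show ?thesis by linarith
  next
    case False
    then have "2 * \<beta> \<le> \<alpha> * w" using assms by (simp add: field_simps)
    then have "(2 * \<beta>) * w ^ 3 \<le> (\<alpha> * w) * w ^ 3" using w0 by (intro mult_right_mono) auto
    then have "\<beta> * w ^ 3 \<le> \<alpha> / 2 * w ^ 4" by (simp add: eval_nat_numeral)
    moreover have "0 \<le> \<beta> * (2 * \<beta> / \<alpha>) ^ 3" using assms by simp
    moreover have "\<alpha> * w ^ 4 = \<alpha> / 2 * w ^ 4 + \<alpha> / 2 * w ^ 4" by simp
    ultimately show ?thesis by linarith
  qed
  then have "z * exp (\<beta> * z powr (3/4) - \<alpha> * z) \<le> z * exp (\<beta> * (2 * \<beta> / \<alpha>) ^ 3 - \<alpha> / 2 * z)"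
    using assms by (auto simp: w3 simp flip: w4)
  also have "\<dots> = (\<alpha> / 2 * z) * exp (- (\<alpha> / 2 * z)) * (2 / \<alpha>) * exp (\<beta> * (2 * \<beta> / \<alpha>) ^ 3)"
  proof -
    have e: "exp (\<beta> * (2 * \<beta> / \<alpha>) ^ 3 - \<alpha> / 2 * z) = exp (- (\<alpha> / 2 * z)) * exp (\<beta> * (2 * \<beta> / \<alpha>) ^ 3)"
      by (simp flip: exp_add)
    show ?thesis unfolding e using assms by simp
  qed
  also have "\<dots> \<le> 1 * (2 / \<alpha>) * exp (\<beta> * (2 * \<beta> / \<alpha>) ^ 3)"
  proof (intro mult_right_mono)
    show "(\<alpha> / 2 * z) * exp (- (\<alpha> / 2 * z)) \<le> 1"
      using exp_ge_add_one_self[of "\<alpha> / 2 * z"] by (simp add: exp_minus field_simps)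
  qed (use assms in auto)
  finally show ?thesis by simp
qed

text \<open>The difference splits into \<open>(\<Phi> t - 1)\<close> times the Gaussian and
  \<open>\<Phi> t * e\<close> times the Gaussian. \<open>S\<close> is the frequency cutoff,
  \<open>d\<close> stands for the smallest eigenvalue and \<open>z\<close> for
  \<open>\<sigma>\<^sub>N\<^sup>C\<close>; they are free real variables so that \<open>K\<close> is
  fixed before any of them.\<close>

lemma char_close:
  fixes \<Phi> :: "real^'m \<Rightarrow> complex"
  assumes \<Phi>: "C1_on \<Phi> {t. norm t < 2}" "\<Phi> 0 = 1"
    and gr: "exp_growth \<Phi> A \<beta>" "1 \<le> A" "0 \<le> \<beta>" and \<alpha>: "0 < \<alpha>"
  obtains K where "0 \<le> K"
    "\<And>S d z t q \<phi> e. 1 \<le> S \<Longrightarrow> 1 \<le> d \<Longrightarrow> S \<le> sqrt d \<Longrightarrow> S powr A \<le> sqrt d \<Longrightarrow>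
      1 \<le> z \<Longrightarrow> S \<le> z \<Longrightarrow> S powr A \<le> z powr (3/4) \<Longrightarrow> norm t \<le> S \<Longrightarrow> d * (norm t)\<^sup>2 \<le> q \<Longrightarrow>
      norm e \<le> c * (1 / exp (\<alpha> * z)) \<Longrightarrow> \<phi> = \<Phi> t * complex_of_real (exp (- q / 2)) * (1 + e) \<Longrightarrow>
      norm (\<phi> - complex_of_real (exp (- q / 2))) \<le> K / S * exp (- q / 4)"
proof -
  obtain L where L: "0 \<le> L" "\<And>t. norm t \<le> 1 \<Longrightarrow> norm (\<Phi> t - \<Phi> 0) \<le> L * norm t"
    using C1_lipschitz_at_0[OF \<Phi>(1)] by blast
  obtain B0 where B0: "\<And>t. norm (\<Phi> t) \<le> B0 * exp (\<beta> * norm t powr A)"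
    using gr(1) unfolding exp_growth_def by blast
  define B where "B = max 1 B0"
  have B: "1 \<le> B" "norm (\<Phi> t) \<le> B * exp (\<beta> * norm t powr A)" for t
    using B0[of t] by (auto simp: B_def intro: order_trans mult_right_mono)
  define K1 where "K1 = exp ((\<beta> + 1)\<^sup>2)"
  define K2 where "K2 = 2 / \<alpha> * exp (\<beta> * (2 * \<beta> / \<alpha>) ^ 3)"
  have K12: "0 \<le> K1" "0 \<le> K2" using \<alpha> by (auto simp: K1_def K2_def)
  \<comment> \<open>The three summands come from the unit ball, from \<open>t\<close> outside it,
    and from the relative error \<open>e\<close>.\<close>
  define K where "K = L + 2 * B * K1 + \<bar>c\<bar> * B * K2"
  show ?thesis
  proof (rule that[of K])
    show "0 \<le> K" unfolding K_def using L(1) B(1) K12 by simp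
    fix S d z q :: real and t and \<phi> e :: complex
    assume S: "1 \<le> S" and d: "1 \<le> d" and Sd: "S \<le> sqrt d" and SAd: "S powr A \<le> sqrt d"
      and z: "1 \<le> z" and Sz: "S \<le> z" and SAz: "S powr A \<le> z powr (3/4)" and t: "norm t \<le> S"
      and q: "d * (norm t)\<^sup>2 \<le> q" and e: "norm e \<le> c * (1 / exp (\<alpha> * z))"
      and \<phi>: "\<phi> = \<Phi> t * complex_of_real (exp (- q / 2)) * (1 + e)"
    have q0: "0 \<le> q" using q d by (meson mult_nonneg_nonneg order_trans zero_le_one zero_le_power2)
    have tA: "norm t powr A \<le> S powr A" using t gr(2) by (intro powr_mono2) auto
    have \<Phi>S: "norm (\<Phi> t) \<le> B * exp (\<beta> * x)" if "S powr A \<le> x" for x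
    proof -
      have "\<beta> * norm t powr A \<le> \<beta> * x" using tA that gr(3) by (intro mult_left_mono) auto
      then have "B * exp (\<beta> * norm t powr A) \<le> B * exp (\<beta> * x)" using B(1) by simp
      then show ?thesis using B(2)[of t] by linarith
    qed
    have one: "norm (\<Phi> t - 1) * exp (- q / 2) \<le> (L + 2 * B * K1) / S * exp (- q / 4)"
    proof (cases "norm t \<le> 1")
      case True
      have "norm (\<Phi> t - 1) * exp (- q / 2) \<le> L * (norm t * exp (- q / 2))"
        using L(2)[OF True] \<Phi>(2) by (simp add: mult_right_mono flip: mult.assoc)
      also have "\<dots> \<le> L * (exp (- q / 4) / sqrt d)"
        by (intro mult_left_mono gaussian_linear_bound d q L)
      also have "\<dots> \<le> L * (exp (- q / 4) / S)"
        using L(1) Sd S by (intro mult_left_mono frac_le) auto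
      also have "\<dots> \<le> (L + 2 * B * K1) * (exp (- q / 4) / S)"
        using S B(1) K12 by (intro mult_right_mono) auto
      finally show ?thesis by simp
    next
      case False
      define r where "r = sqrt d"
      have r: "1 \<le> r" "r\<^sup>2 = d" using d by (auto simp: r_def)
      \<comment> \<open>Outside the unit ball \<open>q \<ge> d\<close>, so part of the Gaussian is
        at most \<open>exp (- d / 4)\<close>. This beats the growth of \<open>\<Phi>\<close>, which
        is at most \<open>exp (\<beta> * sqrt d)\<close> up to a constant, with a factor
        \<open>1 / sqrt d\<close> to spare.\<close>
      have "d * 1 \<le> d * (norm t)\<^sup>2" using False d by (intro mult_left_mono) auto
      then have dq: "d \<le> q" using q by simp
      have "norm (\<Phi> t - 1) \<le> norm (\<Phi> t) + 1" by (rule norm_triangle_le_diff) simp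
      also have "\<dots> \<le> B * exp (\<beta> * r) + B * exp (\<beta> * r)"
      proof (intro add_mono)
        show "norm (\<Phi> t) \<le> B * exp (\<beta> * r)" using \<Phi>S SAd by (simp add: r_def)
        have "1 * 1 \<le> B * exp (\<beta> * r)" using B(1) gr(3) r by (intro mult_mono) auto
        then show "1 \<le> B * exp (\<beta> * r)" by simp
      qed
      finally have "norm (\<Phi> t - 1) * exp (- q / 2) \<le> 2 * B * exp (\<beta> * r) * (exp (- q / 4) * exp (- q / 4))"
        by (simp add: mult_right_mono flip: exp_add)
      also have "\<dots> \<le> 2 * B * exp (\<beta> * r) * (exp (- d / 4) * exp (- q / 4))"
        using B(1) dq by (intro mult_left_mono mult_right_mono) auto
      also have "\<dots> = 2 * B * (r * exp (\<beta> * r - r\<^sup>2 / 4)) / r * exp (- q / 4)"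
      proof -
        have "exp (\<beta> * r - r\<^sup>2 / 4) = exp (\<beta> * r) * exp (- d / 4)"
          by (simp add: r(2) flip: exp_add)
        then show ?thesis using r(1) by simp
      qed
      also have "\<dots> \<le> 2 * B * K1 / S * exp (- q / 4)"
      proof -
        have "r * exp (\<beta> * r - r\<^sup>2 / 4) \<le> K1"
          unfolding K1_def using r gr(3) by (intro exp_quadratic_bound) auto
        then show ?thesis
          using B(1) K12 S Sd by (intro mult_right_mono frac_le mult_left_mono) (auto simp: r_def)
      qed
      also have "\<dots> \<le> (L + 2 * B * K1) / S * exp (- q / 4)"
        using L(1) S by (intro mult_right_mono divide_right_mono) auto
      finally show ?thesis .
    qed
    \<comment> \<open>Here the Gaussian gives no saving; the factor
      \<open>exp (- \<alpha> * z)\<close> in the bound for \<open>e\<close> beats the growth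
      \<open>exp (\<beta> * z powr (3/4))\<close> and leaves
      \<open>1 / z \<le> 1 / S\<close>.\<close>
    have two: "norm (\<Phi> t) * exp (- q / 2) * norm e \<le> \<bar>c\<bar> * B * K2 / S * exp (- q / 4)"
    proof -
      have "norm e \<le> \<bar>c\<bar> * exp (- (\<alpha> * z))"
      proof -
        have "c * (1 / exp (\<alpha> * z)) \<le> \<bar>c\<bar> * (1 / exp (\<alpha> * z))" by (intro mult_right_mono) auto
        then have "norm e \<le> \<bar>c\<bar> * (1 / exp (\<alpha> * z))" using e by linarith
        also have "1 / exp (\<alpha> * z) = exp (- (\<alpha> * z))" by (simp add: exp_minus divide_inverse)
        finally show ?thesis .
      qed
      then have "norm (\<Phi> t) * norm e \<le> B * exp (\<beta> * z powr (3/4)) * (\<bar>c\<bar> * exp (- (\<alpha> * z)))"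
        using \<Phi>S[OF SAz] B(1) by (intro mult_mono) auto
      also have "\<dots> = \<bar>c\<bar> * B * (z * exp (\<beta> * z powr (3/4) - \<alpha> * z)) / z"
      proof -
        have "exp (\<beta> * z powr (3/4) - \<alpha> * z) = exp (\<beta> * z powr (3/4)) * exp (- (\<alpha> * z))"
          by (simp flip: exp_add)
        then show ?thesis using z by simp
      qed
      also have "\<dots> \<le> \<bar>c\<bar> * B * K2 / S"
      proof (rule frac_le)
        show "0 \<le> \<bar>c\<bar> * B * K2" using B(1) K12(2) by simp
        show "\<bar>c\<bar> * B * (z * exp (\<beta> * z powr (3/4) - \<alpha> * z)) \<le> \<bar>c\<bar> * B * K2"
          unfolding K2_def
          by (rule mult_left_mono[OF exp_three_quarter_bound[OF z \<alpha> gr(3)]]) (use B(1) in simp)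
      qed (use S Sz in auto)
      finally have le: "norm (\<Phi> t) * norm e \<le> \<bar>c\<bar> * B * K2 / S" .
      have "norm (\<Phi> t) * norm e * exp (- q / 2) \<le> \<bar>c\<bar> * B * K2 / S * exp (- q / 4)"
        by (rule mult_mono[OF le]) (use q0 B(1) K12 S in auto)
      then show ?thesis by (simp add: mult_ac)
    qed
    have "\<phi> - complex_of_real (exp (- q / 2)) =
      (\<Phi> t - 1) * complex_of_real (exp (- q / 2)) + \<Phi> t * complex_of_real (exp (- q / 2)) * e"
      unfolding \<phi> by (simp add: algebra_simps)
    then have "norm (\<phi> - complex_of_real (exp (- q / 2))) \<le>
      norm (\<Phi> t - 1) * exp (- q / 2) + norm (\<Phi> t) * exp (- q / 2) * norm e"
      using norm_triangle_ineq[of "(\<Phi> t - 1) * complex_of_real (exp (- q / 2))"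
          "\<Phi> t * complex_of_real (exp (- q / 2)) * e"]
      by (simp add: norm_mult)
    also have "\<dots> \<le> K / S * exp (- q / 4)"
      using one two by (simp add: K_def add_divide_distrib distrib_right)
    finally show "norm (\<phi> - complex_of_real (exp (- q / 2))) \<le> K / S * exp (- q / 4)" .
  qed
qed

text \<open>Each entry of the maximum serves one purpose for
  \<open>S = \<sigma> powr (1 / D)\<close>: \<open>1 / a\<close> keeps \<open>S\<close> in the range
  of the approximation, \<open>A / C\<close> controls it by \<open>\<sigma> powr C\<close>, and the
  entry with \<open>\<mu>\<close> controls it by \<open>sqrt d\<close> through
  \<open>\<sigma> \<le> d powr (\<mu> * m)\<close>. There is room for any exponent \<open>A'\<close>
  up to \<open>3 / 2 * A\<close>.\<close>

lemma scale_bounds: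
  fixes \<sigma> d D A A' C a \<mu> m :: real
  assumes \<sigma>: "1 \<le> \<sigma>" and d: "1 \<le> d" "\<sigma> \<le> d powr (\<mu> * m)" and m: "1 \<le> m" and \<mu>: "0 < \<mu>"
    and A: "1 \<le> A" "A' \<le> 3 / 2 * A" and aC: "0 < a" "0 < C"
    and D: "D > 2 * (m + 1 + Max {1 / a, A / C, 3 * m * (m + 1) * \<mu> * A})"
  shows "0 < D" "1 \<le> \<sigma> powr (1 / D)" "\<sigma> powr (1 / D) \<le> \<sigma> powr a"
    "\<sigma> powr (1 / D) \<le> sqrt d" "(\<sigma> powr (1 / D)) powr A' \<le> sqrt d"
    "\<sigma> powr (1 / D) \<le> \<sigma> powr C" "(\<sigma> powr (1 / D)) powr A' \<le> (\<sigma> powr C) powr (3 / 4)"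
proof -
  define W where "W = Max {1 / a, A / C, 3 * m * (m + 1) * \<mu> * A}"
  have W: "1 / a \<le> W" "A / C \<le> W" "3 * m * (m + 1) * \<mu> * A \<le> W" by (auto simp: W_def)
  have D': "D > 2 * m + 2 + 2 * W" using D unfolding W_def by (simp only: distrib_left mult_1_right)
  have W0: "0 < 1 / a" "0 < A / C" using aC A by auto
  show D0: "0 < D" using D' W W0 m by linarith
  have Da: "1 / D \<le> a"
  proof -
    have "1 / a \<le> D" using D' W W0 m by linarith
    then show ?thesis using aC D0 by (simp add: field_simps)
  qed
  have DC: "3 / 2 * A / D \<le> 3 / 4 * C"
  proof -
    have "2 * (A / C) \<le> D" using D' W W0 m by linarith
    then show ?thesis using aC D0 by (simp add: field_simps)
  qed
  have DC': "1 / D \<le> C"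
  proof -
    have "1 / C \<le> A / C" using A aC by (intro divide_right_mono) auto
    then have "1 / C \<le> D" using D' W W0 m by linarith
    then show ?thesis using aC D0 by (simp add: field_simps)
  qed
  have D\<mu>: "\<mu> * m * (3 / 2 * A / D) \<le> 1 / 2"
  proof -
    have "3 * m * \<mu> * A * 1 \<le> 3 * m * \<mu> * A * (m + 1)"
      using m \<mu> A by (intro mult_left_mono) auto
    moreover have "3 * m * \<mu> * A * (m + 1) = 3 * m * (m + 1) * \<mu> * A" by (simp only: mult_ac)
    ultimately have "3 * m * \<mu> * A \<le> D" using D' W W0 m by linarith
    then show ?thesis using D0 by (simp add: field_simps)
  qed
  show S1: "1 \<le> \<sigma> powr (1 / D)" using \<sigma> D0 by (simp add: ge_one_powr_ge_zero)
  show "\<sigma> powr (1 / D) \<le> \<sigma> powr a" using Da \<sigma> by (intro powr_mono) auto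
  show "\<sigma> powr (1 / D) \<le> \<sigma> powr C" using DC' \<sigma> by (intro powr_mono) auto
  have "\<sigma> powr (3 / 2 * A / D) \<le> (d powr (\<mu> * m)) powr (3 / 2 * A / D)"
    using \<sigma> d D0 A by (intro powr_mono2) auto
  also have "\<dots> = d powr (\<mu> * m * (3 / 2 * A / D))" by (rule powr_powr)
  also have "\<dots> \<le> d powr (1 / 2)" using D\<mu> d by (intro powr_mono) auto
  also have "\<dots> = sqrt d" using d by (simp add: powr_half_sqrt)
  finally have sq: "\<sigma> powr (3 / 2 * A / D) \<le> sqrt d" .
  have "\<sigma> powr (1 / D) \<le> \<sigma> powr (3 / 2 * A / D)"
    using \<sigma> A D0 by (intro powr_mono divide_right_mono) auto
  then show "\<sigma> powr (1 / D) \<le> sqrt d" using sq by linarith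
  have "(\<sigma> powr (1 / D)) powr A' = \<sigma> powr (1 / D * A')" by (rule powr_powr)
  also have "\<dots> \<le> \<sigma> powr (3 / 2 * A / D)"
    using \<sigma> A(2) D0 divide_right_mono[of A' "3 / 2 * A" D] by (intro powr_mono) auto
  finally have S: "(\<sigma> powr (1 / D)) powr A' \<le> \<sigma> powr (3 / 2 * A / D)" .
  then show "(\<sigma> powr (1 / D)) powr A' \<le> sqrt d" using sq by linarith
  have "\<sigma> powr (3 / 2 * A / D) \<le> \<sigma> powr (3 / 4 * C)" using DC \<sigma> by (intro powr_mono) auto
  also have "\<dots> = (\<sigma> powr C) powr (3 / 4)" by (simp add: powr_powr mult.commute)
  finally show "(\<sigma> powr (1 / D)) powr A' \<le> (\<sigma> powr C) powr (3 / 4)" using S by linarith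
qed

section \<open>Normalization of the limiting function and choice of its growth exponent\<close>

lemma mod_gaussian_limit_0:
  assumes "balanced_mod_gaussian M X Q \<delta> \<mu> \<Phi>"
  shows "\<Phi> 0 = 1"
proof -
  interpret prob_space M using assms by (simp add: balanced_mod_gaussian_def)
  have Q: "Q N 0 = 0" if "1 \<le> N" for N
    using assms that eigenvalue_list_zero unfolding balanced_mod_gaussian_def by blast
  have "mod_gaussian M X Q \<Phi>" using assms by (simp add: balanced_mod_gaussian_def)
  then obtain r where "r > 0" and u: "uniform_limit (ball 0 r)
        (\<lambda>N t. complex_of_real (exp (Q N t / 2)) * char_vec M (X N) t) \<Phi> sequentially"
    unfolding mod_gaussian_def by blast
  then have l: "(\<lambda>N. complex_of_real (exp (Q N 0 / 2)) * char_vec M (X N) 0) \<longlonglongrightarrow> \<Phi> 0"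
    by (intro tendsto_uniform_limitI[OF u]) simp
  have "\<forall>\<^sub>F N in sequentially. complex_of_real (exp (Q N 0 / 2)) * char_vec M (X N) 0 = 1"
    using eventually_ge_at_top[of 1]
    by eventually_elim (simp add: Q char_vec_def prob_space)
  then have "(\<lambda>N. complex_of_real (exp (Q N 0 / 2)) * char_vec M (X N) 0) \<longlonglongrightarrow> 1"
    by (rule tendsto_eventually)
  then show ?thesis using l LIMSEQ_unique by blast
qed

text \<open>The constants may depend on \<open>\<Phi>\<close> but not on the exponent \<open>A\<close> that occurs in the bound on \<open>D\<close>, and
  the infimum of the admissible exponents need not be attained; the loss of \<open>3 / 2\<close> is absorbed by the
  factor \<open>2\<close> in that bound.\<close>

lemma near_minimal_growth_exponent:
  fixes \<Phi> :: "real^'m \<Rightarrow> complex"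
  assumes "1 \<le> A\<^sub>0" "0 \<le> \<beta>\<^sub>0" "exp_growth \<Phi> A\<^sub>0 \<beta>\<^sub>0"
  obtains A' \<beta>' where "1 \<le> A'" "0 \<le> \<beta>'" "exp_growth \<Phi> A' \<beta>'"
    "\<And>A \<beta>. 1 \<le> A \<Longrightarrow> 0 \<le> \<beta> \<Longrightarrow> exp_growth \<Phi> A \<beta> \<Longrightarrow> A' \<le> 3 / 2 * A"
proof -
  define E where "E = {A. 1 \<le> A \<and> (\<exists>\<beta>\<ge>0. exp_growth \<Phi> A \<beta>)}"
  have ne: "E \<noteq> {}" using assms by (auto simp: E_def)
  have bdd: "bdd_below E" by (rule bdd_belowI[of _ 1]) (simp add: E_def)
  have "1 \<le> Inf E" by (rule cInf_greatest[OF ne]) (simp add: E_def)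
  then have "Inf E < 3 / 2 * Inf E" by simp
  then obtain A' where A': "A' \<in> E" "A' < 3 / 2 * Inf E"
    using cInf_lessD[OF ne] by blast
  then obtain \<beta>' where "1 \<le> A'" "0 \<le> \<beta>'" "exp_growth \<Phi> A' \<beta>'" by (auto simp: E_def)
  moreover have "A' \<le> 3 / 2 * A" if "1 \<le> A" "0 \<le> \<beta>" "exp_growth \<Phi> A \<beta>" for A \<beta>
  proof -
    have "Inf E \<le> A" using that by (intro cInf_lower bdd) (auto simp: E_def)
    then show ?thesis using A'(2) by linarith
  qed
  ultimately show ?thesis by (rule that)
qed

section \<open>Box probabilities compared with the Gaussian cube integral\<close>

lemma cube_norm_le:
  fixes t :: "real^'m" and T :: real
  assumes "\<forall>b\<in>Basis. \<bar>t \<bullet> b\<bar> \<le> T"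
  shows "norm t \<le> CARD('m) * T"
proof -
  have "norm t \<le> (\<Sum>b\<in>Basis. \<bar>t \<bullet> b\<bar>)" by (rule norm_le_l1)
  also have "\<dots> \<le> (\<Sum>b\<in>(Basis::(real^'m) set). T)" using assms by (intro sum_mono) auto
  finally show ?thesis by simp
qed

definition gauss_char :: "(real^'m \<Rightarrow> real) \<Rightarrow> real^'m \<Rightarrow> complex" where
  "gauss_char q t = complex_of_real (exp (- q t / 2))"

lemma gauss_char_measurable:
  "eigenvalue_list q ds \<Longrightarrow> gauss_char q \<in> borel_measurable borel"
  using eigenvalue_list_measurable[of q ds] unfolding gauss_char_def[abs_def] by measurable

text \<open>The dimension enters through a type argument, since \<open>K\<close> does not determine
  it. The extra factor \<open>CARD('m)\<close> comes from the cutoff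
  \<open>T = S / CARD('m)\<close>, and the power of \<open>sqrt (4 * pi)\<close> from integrating
  the majorant \<open>exp (- q t / 4)\<close>.\<close>

definition box_const :: "'m::finite itself \<Rightarrow> real \<Rightarrow> real" where
  "box_const _ K = (K + (K + 1) * (real CARD('m) * (1 + 960 * real CARD('m)) ^ CARD('m) * 480) * CARD('m)) *
    sqrt (4 * pi) ^ CARD('m)"

lemma box_const_mono:
  assumes "0 \<le> K"
  shows "0 \<le> box_const TYPE('m::finite) 0" "box_const TYPE('m) 0 \<le> box_const TYPE('m) K"
proof -
  define B where "B = real CARD('m) * (1 + 960 * real CARD('m)) ^ CARD('m) * 480"
  have B: "0 \<le> B" by (simp add: B_def)
  have e: "box_const TYPE('m) k = (k + (k + 1) * B * CARD('m)) * sqrt (4 * pi) ^ CARD('m)" for k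
    by (simp only: box_const_def B_def)
  show "0 \<le> box_const TYPE('m) 0" unfolding e using B by simp
  show "box_const TYPE('m) 0 \<le> box_const TYPE('m) K"
    unfolding e using B assms by (intro mult_right_mono add_mono) auto
qed

text \<open>The half-side \<open>S / CARD('m)\<close> puts the cube inside the ball of radius
  \<open>S\<close>, where the comparison is available. The majorant is
  \<open>exp (- q t / 4)\<close>, whose integral supplies the
  \<open>1 / sqrt (prod_list ds)\<close>.\<close>

lemma box_estimate:
  fixes Z :: "'a \<Rightarrow> real^'m"
  assumes M: "prob_space M" "Z \<in> borel_measurable M"
    and q: "eigenvalue_list q ds" "\<And>d. d \<in> set ds \<Longrightarrow> 0 < d" "\<And>t. 0 \<le> q t"
    and S: "1 \<le> S" and \<epsilon>: "0 < \<epsilon>" "\<epsilon> \<le> 1" and K: "0 \<le> K"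
    and close: "\<And>t. norm t \<le> S \<Longrightarrow> norm (char_vec M Z t - gauss_char q t) \<le> K / S * exp (- q t / 4)"
  shows "\<bar>\<P>(\<omega> in M. infnorm (Z \<omega> - x\<^sub>0) < \<epsilon>) - Re (cube_integral (S / CARD('m)) \<epsilon> x\<^sub>0 (gauss_char q))\<bar>
    \<le> box_const TYPE('m) K / (S * sqrt (prod_list ds))"
proof -
  let ?m = "real CARD('m)"
  define B where "B = ?m * (1 + 960 * ?m) ^ CARD('m) * 480"
  have B: "0 \<le> B" by (simp add: B_def)
  have G: "integrable lborel (\<lambda>t. exp (- q t / 4))"
    "(LINT t|lborel. exp (- q t / 4)) = sqrt (4 * pi) ^ CARD('m) / sqrt (prod_list ds)"
    using gaussian_integral[OF q(1,2), of "1 / 4"] by (simp_all add: mult.commute)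
  have "\<bar>\<P>(\<omega> in M. infnorm (Z \<omega> - x\<^sub>0) < \<epsilon>) - Re (cube_integral (S / ?m) \<epsilon> x\<^sub>0 (gauss_char q))\<bar>
    \<le> (K / S + (K / S + 1) * B / (S / ?m)) * (LINT t|lborel. exp (- q t / 4))"
    unfolding B_def
  proof (rule box_probability_approx[OF M _ \<epsilon> G(1)])
    show "1 / ?m \<le> S / ?m" using S by (intro divide_right_mono) auto
    show "norm (gauss_char q t) \<le> exp (- q t / 4)" for t
      using q(3)[of t] by (simp add: gauss_char_def)
    show "norm (char_vec M Z t - gauss_char q t) \<le> K / S * exp (- q t / 4)"
      if "\<forall>b\<in>Basis. \<bar>t \<bullet> b\<bar> \<le> S / ?m" for t
      using cube_norm_le[OF that] by (intro close) simp
  qed (use S K gauss_char_measurable[OF q(1)] in auto)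
  also have "\<dots> \<le> (K / S + (K + 1) * B * ?m / S) * (LINT t|lborel. exp (- q t / 4))"
  proof (intro mult_right_mono add_left_mono)
    have "K / S \<le> K" using S K mult_left_mono[of 1 S K] by (simp add: divide_le_eq)
    then have "(K / S + 1) * B * ?m / S \<le> (K + 1) * B * ?m / S"
      using B S by (intro divide_right_mono mult_right_mono) auto
    then show "(K / S + 1) * B / (S / ?m) \<le> (K + 1) * B * ?m / S" by simp
  qed simp
  also have "\<dots> = box_const TYPE('m) K / (S * sqrt (prod_list ds))"
    unfolding G(2) box_const_def B_def[symmetric] by (simp add: add_divide_distrib distrib_right)
  finally show ?thesis .
qed

section \<open>Lower bound for the Gaussian cube integral\<close>

lemma sinc_near_1: "\<bar>sinc x - 1\<bar> \<le> \<bar>x\<bar>"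
proof -
  have pos: "\<bar>sinc y - 1\<bar> \<le> y" if y: "0 < y" for y
  proof -
    obtain \<xi> where \<xi>: "0 < \<xi>" "\<xi> < y" "sin y - sin 0 = (y - 0) * cos \<xi>"
      using MVT2[OF y, of sin cos] by (auto intro: DERIV_sin)
    have "sinc y - 1 = cos \<xi> - 1" using \<xi> y by simp
    also have "\<dots> = - (2 * (sin (\<xi> / 2))\<^sup>2)" using cos_double_sin[of "\<xi> / 2"] by simp
    finally have "\<bar>sinc y - 1\<bar> = 2 * (\<bar>sin (\<xi> / 2)\<bar> * \<bar>sin (\<xi> / 2)\<bar>)"
      by (simp add: power2_eq_square)
    also have "\<dots> \<le> 2 * (\<bar>\<xi> / 2\<bar> * 1)"
      by (intro mult_left_mono mult_mono abs_sin_x_le_abs_x abs_sin_le_one) auto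
    finally show ?thesis using \<xi> by simp
  qed
  show ?thesis
    using pos[of x] pos[of "- x"] sinc_neg[of x] by (cases "x = 0"; cases "0 < x") auto
qed

lemma step_kernel_near_1: "\<bar>step_kernel u - 1\<bar> \<le> 2 * \<bar>u\<bar>"
proof (cases "u \<in> {-1..1}")
  case True
  then have u: "\<bar>u\<bar> \<le> 1" by auto
  then have u2: "u\<^sup>2 \<le> \<bar>u\<bar>"
    using mult_left_mono[OF u, of "\<bar>u\<bar>"] by (simp add: power2_eq_square)
  have "step_kernel u - 1 = u\<^sup>2 * u\<^sup>2 - 2 * u\<^sup>2"
    using True by (simp add: step_kernel_def power2_eq_square algebra_simps)
  moreover have "0 \<le> u\<^sup>2 * u\<^sup>2" by simp
  moreover have "u\<^sup>2 * u\<^sup>2 \<le> u\<^sup>2 * 1"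
    by (rule mult_left_mono) (use u u2 in auto)
  ultimately show ?thesis using u2 zero_le_power2[of u] by linarith
next
  case False
  then show ?thesis by (auto simp: step_kernel_def)
qed

text \<open>At frequency 0 the kernel equals \<open>\<epsilon> / pi\<close>; since
  \<open>1 / T \<le> m\<close>, the Lipschitz constant does not depend on \<open>T\<close>.\<close>

lemma window_kernel_near_0:
  assumes T: "1 / m \<le> T" "0 < m" and \<epsilon>: "0 < \<epsilon>" "\<epsilon> \<le> 1"
  shows "\<bar>window_kernel T \<epsilon> s - \<epsilon> / pi\<bar> \<le> (2 * m + 1) * \<bar>s\<bar>"
proof -
  have T0: "0 < T" using T by (auto intro: less_le_trans[rotated])
  have Tm: "1 / T \<le> m" using T T0 by (simp add: field_simps)
  define p y where "p = step_kernel (s / T)" and "y = sinc (s * \<epsilon>)"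
  have "window_kernel T \<epsilon> s - \<epsilon> / pi = \<epsilon> / pi * ((p - 1) * y + (y - 1))"
    unfolding window_kernel_def p_def[symmetric] y_def[symmetric] by (simp add: field_simps)
  then have "\<bar>window_kernel T \<epsilon> s - \<epsilon> / pi\<bar> = \<epsilon> / pi * \<bar>(p - 1) * y + (y - 1)\<bar>"
    using \<epsilon> by (simp add: abs_mult)
  also have "\<dots> \<le> 1 * (\<bar>p - 1\<bar> * \<bar>y\<bar> + \<bar>y - 1\<bar>)"
    using \<epsilon> pi_gt3 abs_triangle_ineq[of "(p - 1) * y" "y - 1"]
    by (intro mult_mono) (auto simp: abs_mult)
  also have "\<dots> \<le> 1 * (2 * \<bar>s / T\<bar> * 1 + \<bar>s * \<epsilon>\<bar>)"
    unfolding p_def y_def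
    by (intro mult_left_mono add_mono mult_mono step_kernel_near_1 sinc_bound sinc_near_1) auto
  also have "\<dots> = (2 * (1 / T) + \<epsilon>) * \<bar>s\<bar>" using T0 \<epsilon> by (simp add: abs_mult algebra_simps)
  also have "\<dots> \<le> (2 * m + 1) * \<bar>s\<bar>" using Tm \<epsilon> by (intro mult_right_mono) auto
  finally show ?thesis .
qed

text \<open>When the smallest eigenvalue is large, the Gaussian concentrates near frequency 0, where
  the kernel is close to \<open>(\<epsilon> / pi) ^ CARD('m)\<close> and the phase to 1. Both
  deviations are linear in \<open>norm t\<close>, so they cost a factor
  \<open>1 / sqrt (hd ds)\<close> relative to the main term.\<close>

lemma cube_integral_lower_bound:
  fixes x\<^sub>0 :: "real^'m"
  assumes q: "eigenvalue_list q ds" "\<And>d. d \<in> set ds \<Longrightarrow> 0 < d" and hd: "1 \<le> hd ds"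
    and S: "1 \<le> S" and \<epsilon>: "0 < \<epsilon>" "\<epsilon> \<le> 1"
  defines "m \<equiv> real CARD('m)"
  shows "((\<epsilon> / pi) ^ CARD('m) * sqrt (2 * pi) ^ CARD('m)
      - (m * (2 * m + 1) + norm x\<^sub>0) * sqrt (4 * pi) ^ CARD('m) / sqrt (hd ds)) / sqrt (prod_list ds)
    \<le> Re (cube_integral (S / m) \<epsilon> x\<^sub>0 (gauss_char q))"
proof -
  define T where "T = S / m"
  have m: "0 < m" "1 / m \<le> T" using S by (auto simp: m_def T_def divide_right_mono)
  have T0: "0 < T" using S m by (simp add: T_def)
  let ?I = "\<lambda>t. complex_of_real (\<Prod>b\<in>Basis. window_kernel T \<epsilon> (t \<bullet> b)) * iexp (- (t \<bullet> x\<^sub>0)) * gauss_char q t"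
  let ?c = "(\<epsilon> / pi) ^ CARD('m)"
  let ?L = "m * (2 * m + 1) + norm x\<^sub>0"
  note [measurable] = eigenvalue_list_measurable[OF q(1)] gauss_char_measurable[OF q(1)]
  have G4: "integrable lborel (\<lambda>t. exp (- q t / 4))"
    "(LINT t|lborel. exp (- q t / 4)) = sqrt (4 * pi) ^ CARD('m) / sqrt (prod_list ds)"
    using gaussian_integral[OF q, of "1 / 4"] by (simp_all add: mult.commute)
  have G2: "integrable lborel (\<lambda>t. exp (- q t / 2))"
    "(LINT t|lborel. exp (- q t / 2)) = sqrt (2 * pi) ^ CARD('m) / sqrt (prod_list ds)"
    using gaussian_integral[OF q, of "1 / 2"] by (simp_all add: mult.commute)
  have wb: "\<bar>window_kernel T \<epsilon> s\<bar> \<le> 1" for s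
    using window_kernel_bound[OF T0 \<epsilon>, of s] by (auto simp: indicator_def split: if_splits intro: order_trans)
  have Pb: "\<bar>\<Prod>b\<in>Basis. window_kernel T \<epsilon> (t \<bullet> b)\<bar> \<le> 1" for t :: "real^'m"
    using wb by (auto simp: abs_prod intro!: prod_le_1)
  have Ii: "integrable lborel ?I"
  proof (rule Bochner_Integration.integrable_bound[OF G2(1)])
    show "AE t in lborel. norm (?I t) \<le> norm (exp (- q t / 2))"
    proof (rule AE_I2)
      fix t :: "real^'m"
      have "norm (?I t) = \<bar>\<Prod>b\<in>Basis. window_kernel T \<epsilon> (t \<bullet> b)\<bar> * exp (- q t / 2)"
        by (simp only: norm_mult norm_of_real norm_exp_i_times gauss_char_def abs_exp_cancel mult_1_right)
      also have "\<dots> \<le> 1 * exp (- q t / 2)" using Pb by (intro mult_right_mono) auto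
      finally show "norm (?I t) \<le> norm (exp (- q t / 2))" by simp
    qed
  qed measurable
  have Ci: "integrable lborel (\<lambda>t. complex_of_real (?c * exp (- q t / 2)))"
    using G2(1) by (intro integrable_of_real) simp
  have ptw: "norm (?I t - complex_of_real (?c * exp (- q t / 2))) \<le> ?L / sqrt (hd ds) * exp (- q t / 4)" for t :: "real^'m"
  proof -
    define P where "P = (\<Prod>b\<in>Basis. window_kernel T \<epsilon> (t \<bullet> b))"
    have "norm ((\<Prod>b\<in>Basis. window_kernel T \<epsilon> (t \<bullet> b)) - (\<Prod>b\<in>(Basis::(real^'m) set). \<epsilon> / pi)) \<le>
      real (card (Basis::(real^'m) set)) * 1 ^ card (Basis::(real^'m) set) * ((2 * m + 1) * norm t)"
    proof (rule norm_prod_diff_bound)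
      fix b :: "real^'m" assume b: "b \<in> Basis"
      have "norm (window_kernel T \<epsilon> (t \<bullet> b) - \<epsilon> / pi) \<le> (2 * m + 1) * \<bar>t \<bullet> b\<bar>"
        using window_kernel_near_0[OF m(2,1) \<epsilon>] by simp
      also have "\<dots> \<le> (2 * m + 1) * norm t"
        using Basis_le_norm[OF b] m by (intro mult_left_mono) auto
      finally show "norm (window_kernel T \<epsilon> (t \<bullet> b) - \<epsilon> / pi) \<le> (2 * m + 1) * norm t" .
    qed (use wb \<epsilon> pi_gt3 in auto)
    then have P: "\<bar>P - ?c\<bar> \<le> m * (2 * m + 1) * norm t" by (simp add: P_def m_def)
    have c1: "\<bar>?c\<bar> \<le> 1" using \<epsilon> pi_gt3 by (simp add: power_le_one)
    have ie: "norm (iexp (- (t \<bullet> x\<^sub>0)) - 1) \<le> norm t * norm x\<^sub>0"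
    proof -
      have "norm (iexp (- (t \<bullet> x\<^sub>0)) - 1) \<le> \<bar>t \<bullet> x\<^sub>0\<bar>" using iexp_approx1[of "- (t \<bullet> x\<^sub>0)" 0] by simp
      also have "\<dots> \<le> norm t * norm x\<^sub>0" by (rule Cauchy_Schwarz_ineq2)
      finally show ?thesis .
    qed
    have "?I t - complex_of_real (?c * exp (- q t / 2)) =
      (complex_of_real (P - ?c) * iexp (- (t \<bullet> x\<^sub>0)) + complex_of_real ?c * (iexp (- (t \<bullet> x\<^sub>0)) - 1)) * complex_of_real (exp (- q t / 2))"
      unfolding P_def[symmetric] gauss_char_def by (simp only: of_real_diff of_real_mult) (simp only: algebra_simps mult_1_left)
    then have "norm (?I t - complex_of_real (?c * exp (- q t / 2))) =
      norm (complex_of_real (P - ?c) * iexp (- (t \<bullet> x\<^sub>0)) + complex_of_real ?c * (iexp (- (t \<bullet> x\<^sub>0)) - 1)) * exp (- q t / 2)"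
      by (simp only: norm_mult norm_of_real abs_exp_cancel)
    also have "\<dots> \<le> (\<bar>P - ?c\<bar> * 1 + \<bar>?c\<bar> * norm (iexp (- (t \<bullet> x\<^sub>0)) - 1)) * exp (- q t / 2)"
      by (intro mult_right_mono norm_triangle_mono) (simp_all only: norm_mult norm_of_real norm_exp_i_times order_refl exp_ge_zero)
    also have "\<dots> \<le> (m * (2 * m + 1) * norm t * 1 + 1 * (norm t * norm x\<^sub>0)) * exp (- q t / 2)"
      by (rule mult_right_mono[OF add_mono[OF mult_right_mono[OF P] mult_mono[OF c1 ie]]]) auto
    also have "\<dots> = ?L * (norm t * exp (- q t / 2))" by (simp add: algebra_simps)
    also have "\<dots> \<le> ?L * (exp (- q t / 4) / sqrt (hd ds))"
      using m by (intro mult_left_mono gaussian_linear_bound[OF hd eigenvalue_list_ge_hd[OF q(1)]]) auto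
    finally show ?thesis by simp
  qed
  have C: "(CLINT t|lborel. complex_of_real (?c * exp (- q t / 2))) =
      complex_of_real (?c * (sqrt (2 * pi) ^ CARD('m) / sqrt (prod_list ds)))"
    using G2(2) by (simp only: integral_complex_of_real integral_mult_right_zero)
  have "\<bar>Re (cube_integral T \<epsilon> x\<^sub>0 (gauss_char q)) - ?c * (sqrt (2 * pi) ^ CARD('m) / sqrt (prod_list ds))\<bar>
    = \<bar>Re (CLINT t|lborel. ?I t - complex_of_real (?c * exp (- q t / 2)))\<bar>"
    unfolding Bochner_Integration.integral_diff[OF Ii Ci] C cube_integral_def by simp
  also have "\<dots> \<le> (LINT t|lborel. norm (?I t - complex_of_real (?c * exp (- q t / 2))))"
    by (rule order_trans[OF abs_Re_le_cmod integral_norm_bound])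
  also have "\<dots> \<le> (LINT t|lborel. ?L / sqrt (hd ds) * exp (- q t / 4))"
    using Ii Ci G4(1) by (intro integral_mono ptw integrable_norm Bochner_Integration.integrable_diff) auto
  also have "\<dots> = ?L / sqrt (hd ds) * (sqrt (4 * pi) ^ CARD('m) / sqrt (prod_list ds))"
    using G4(2) by (simp only: integral_mult_right_zero)
  finally have "?c * (sqrt (2 * pi) ^ CARD('m) / sqrt (prod_list ds)) -
      ?L / sqrt (hd ds) * (sqrt (4 * pi) ^ CARD('m) / sqrt (prod_list ds)) \<le> Re (cube_integral T \<epsilon> x\<^sub>0 (gauss_char q))"
    by linarith
  then show ?thesis by (simp add: T_def diff_divide_distrib)
qed

section \<open>The box estimates\<close>

text \<open>The order of choice matters: \<open>K\<close> depends on a fixed growth exponent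
  \<open>A'\<close> of \<open>\<Phi>\<close> and precedes the probability space, the sequences,
  \<open>\<mu>\<close>, \<open>A\<close> and \<open>D\<close>. The exponent \<open>A\<close> enters
  only through the bound on \<open>D\<close>.\<close>

lemma mod_gaussian_box_estimate:
  fixes \<Phi> :: "real^'m \<Rightarrow> complex"
  assumes pos: "0 < a" "0 < \<alpha>" "0 < C"
    and \<Phi>: "C1_on \<Phi> {t. norm t < 2}" "\<Phi> 0 = 1" "1 \<le> A'" "0 \<le> \<beta>'" "exp_growth \<Phi> A' \<beta>'"
  obtains K where "0 \<le> K" and
    "\<And>(M :: 'a measure) X Q \<delta> \<mu> A D N x\<^sub>0 \<epsilon>.
      balanced_mod_gaussian M X Q \<delta> \<mu> \<Phi> \<Longrightarrow> char_approx M X Q \<delta> \<Phi> a \<alpha> C c \<Longrightarrow>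
      1 \<le> A \<Longrightarrow> A' \<le> 3 / 2 * A \<Longrightarrow>
      D > 2 * (real CARD('m) + 1 + Max {1 / a, A / C, 3 * real CARD('m) * (real CARD('m) + 1) * \<mu> * A}) \<Longrightarrow>
      1 \<le> N \<Longrightarrow> 0 < \<epsilon> \<Longrightarrow> \<epsilon> \<le> 1 \<Longrightarrow>
      \<bar>\<P>(\<omega> in M. infnorm (X N \<omega> - x\<^sub>0) < \<epsilon>) -
        Re (cube_integral (prod_list (\<delta> N) powr (1 / D) / CARD('m)) \<epsilon> x\<^sub>0 (gauss_char (Q N)))\<bar>
      \<le> box_const TYPE('m) K / (prod_list (\<delta> N) powr (1 / D) * sqrt (prod_list (\<delta> N)))"
proof -
  obtain K where K: "0 \<le> K" and close:
    "\<And>S d z t q \<phi> e. 1 \<le> S \<Longrightarrow> 1 \<le> d \<Longrightarrow> S \<le> sqrt d \<Longrightarrow> S powr A' \<le> sqrt d \<Longrightarrow>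
      1 \<le> z \<Longrightarrow> S \<le> z \<Longrightarrow> S powr A' \<le> z powr (3/4) \<Longrightarrow> norm t \<le> S \<Longrightarrow> d * (norm t)\<^sup>2 \<le> q \<Longrightarrow>
      norm e \<le> c * (1 / exp (\<alpha> * z)) \<Longrightarrow> \<phi> = \<Phi> t * complex_of_real (exp (- q / 2)) * (1 + e) \<Longrightarrow>
      norm (\<phi> - complex_of_real (exp (- q / 2))) \<le> K / S * exp (- q / 4)"
    using char_close[OF \<Phi>(1,2,5,3,4) pos(2), where c=c] by blast
  show ?thesis
  proof (rule that[OF K])
    fix M :: "'a measure" and X Q \<delta> \<mu> and A D \<epsilon> :: real and N :: nat and x\<^sub>0
    assume bal: "balanced_mod_gaussian M X Q \<delta> \<mu> \<Phi>" and ca: "char_approx M X Q \<delta> \<Phi> a \<alpha> C c"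
      and A: "1 \<le> A" "A' \<le> 3 / 2 * A"
      and D: "D > 2 * (real CARD('m) + 1 + Max {1 / a, A / C, 3 * real CARD('m) * (real CARD('m) + 1) * \<mu> * A})"
      and N: "1 \<le> N" and \<epsilon>: "0 < \<epsilon>" "\<epsilon> \<le> 1"
    have M: "prob_space M" "X N \<in> borel_measurable M"
      and q: "nonneg_quadratic_form (Q N)" "eigenvalue_list (Q N) (\<delta> N)"
      and \<mu>: "0 < \<mu>" "last (\<delta> N) \<le> hd (\<delta> N) powr \<mu>" and \<sigma>: "1 \<le> prod_list (\<delta> N)"
      using bal N unfolding balanced_mod_gaussian_def balanced_def by blast+
    note ev = balanced_eigenvalues[OF q \<mu> \<sigma>]
    have m: "1 \<le> real CARD('m)" by (simp add: Suc_leI)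
    \<comment> \<open>Applied with the smallest eigenvalue as \<open>d\<close>, so that the
      conditions of the pointwise comparison hold with
      \<open>z = \<sigma>\<^sub>N\<^sup>C\<close>.\<close>
    note sc = scale_bounds[OF \<sigma> ev(1,3) m \<mu>(1) A pos(1,3) D]
    have z: "1 \<le> prod_list (\<delta> N) powr C" using \<sigma> pos by (simp add: ge_one_powr_ge_zero)
    show "\<bar>\<P>(\<omega> in M. infnorm (X N \<omega> - x\<^sub>0) < \<epsilon>) -
        Re (cube_integral (prod_list (\<delta> N) powr (1 / D) / CARD('m)) \<epsilon> x\<^sub>0 (gauss_char (Q N)))\<bar>
      \<le> box_const TYPE('m) K / (prod_list (\<delta> N) powr (1 / D) * sqrt (prod_list (\<delta> N)))"
    proof (rule box_estimate[OF M q(2) ev(2) _ sc(2) \<epsilon> K])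
      show "0 \<le> Q N t" for t using q(1) by (simp add: nonneg_quadratic_form_def)
      fix t :: "real^'m" assume t: "norm t \<le> prod_list (\<delta> N) powr (1 / D)"
      then have "norm t \<le> prod_list (\<delta> N) powr a" using sc(3) by linarith
      then obtain e where e: "norm e \<le> c * (1 / exp (\<alpha> * prod_list (\<delta> N) powr C))"
        "char_vec M (X N) t = \<Phi> t * complex_of_real (exp (- Q N t / 2)) * (1 + e)"
        using ca N unfolding char_approx_def by blast
      show "norm (char_vec M (X N) t - gauss_char (Q N) t) \<le>
          K / prod_list (\<delta> N) powr (1 / D) * exp (- Q N t / 4)"
        unfolding gauss_char_def
        by (rule close[OF sc(2) ev(1) sc(4,5) z sc(6,7) t eigenvalue_list_ge_hd[OF q(2)] e])
    qed
  qed
qed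

text \<open>The characteristic function is exactly \<open>gauss_char q\<close>, so the comparison
  constant is 0. Both probabilities are thus close to the same cube integral.\<close>

lemma gaussian_vector_box_estimate:
  fixes G :: "'a \<Rightarrow> real^'m"
  assumes M: "prob_space M" "gaussian_vector M G q"
    and q: "eigenvalue_list q ds" "\<And>d. d \<in> set ds \<Longrightarrow> 0 < d" "\<And>t. 0 \<le> q t"
    and S: "1 \<le> S" and \<epsilon>: "0 < \<epsilon>" "\<epsilon> \<le> 1"
  shows "\<bar>\<P>(\<omega> in M. infnorm (G \<omega> - x\<^sub>0) < \<epsilon>) - Re (cube_integral (S / CARD('m)) \<epsilon> x\<^sub>0 (gauss_char q))\<bar>
    \<le> box_const TYPE('m) 0 / (S * sqrt (prod_list ds))"
proof (rule box_estimate[OF M(1) _ q S \<epsilon>])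
  show "G \<in> borel_measurable M" using M(2) by (simp add: gaussian_vector_def)
  show "norm (char_vec M G t - gauss_char q t) \<le> 0 / S * exp (- q t / 4)" for t
  proof -
    have "char_vec M G t = exp (- complex_of_real (q t) / 2)"
      by (rule char_vec_gaussian_vector[OF M q(3)])
    also have "\<dots> = gauss_char q t" by (simp add: gauss_char_def flip: exp_of_real)
    finally show ?thesis by simp
  qed
qed auto

section \<open>Growth of the smallest eigenvalue and boxes inside open sets\<close>

lemma powr_at_top: "0 < p \<Longrightarrow> filterlim (\<lambda>x::real. x powr p) at_top at_top"
  by real_asymp

text \<open>Inverting the balance condition gives
  \<open>last (\<delta> N) powr (1 / \<mu>) \<le> hd (\<delta> N)\<close>.\<close>

lemma balanced_hd_at_top:
  assumes "balanced \<mu> \<delta>" "0 < \<mu>" "\<And>N. 1 \<le> N \<Longrightarrow> 1 \<le> hd (\<delta> N)"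
  shows "filterlim (\<lambda>N. hd (\<delta> N)) at_top sequentially"
proof -
  have "filterlim (\<lambda>N. last (\<delta> N) powr (1 / \<mu>)) at_top sequentially"
    using assms(1,2) unfolding balanced_def
    by (intro filterlim_compose[OF powr_at_top]) auto
  then show ?thesis
  proof (rule filterlim_at_top_mono)
    have "\<forall>\<^sub>F N in sequentially. 0 \<le> last (\<delta> N)"
      using assms(1) unfolding balanced_def filterlim_at_top by blast
    then show "\<forall>\<^sub>F N in sequentially. last (\<delta> N) powr (1 / \<mu>) \<le> hd (\<delta> N)"
      using eventually_ge_at_top[of 1]
    proof eventually_elim
      case (elim N)
      have "last (\<delta> N) powr (1 / \<mu>) \<le> (hd (\<delta> N) powr \<mu>) powr (1 / \<mu>)"
        using elim assms(1,2) unfolding balanced_def by (intro powr_mono2) auto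
      also have "\<dots> = hd (\<delta> N)" using assms(2) assms(3)[OF elim(2)] by (simp add: powr_powr)
      finally show ?case .
    qed
  qed
qed

lemma open_contains_infnorm_box:
  fixes U :: "(real^'m) set"
  assumes "open U" "U \<noteq> {}"
  obtains x\<^sub>0 \<epsilon> where "0 < \<epsilon>" "\<epsilon> \<le> 1" "{x. infnorm (x - x\<^sub>0) < \<epsilon>} \<subseteq> U"
proof -
  obtain x\<^sub>0 r where r: "0 < r" "ball x\<^sub>0 r \<subseteq> U" using assms by (meson equals0I openE)
  define \<epsilon> where "\<epsilon> = min 1 (r / CARD('m))"
  have "{x. infnorm (x - x\<^sub>0) < \<epsilon>} \<subseteq> U"
  proof
    fix x assume "x \<in> {x. infnorm (x - x\<^sub>0) < \<epsilon>}"
    then have i: "infnorm (x - x\<^sub>0) < r / CARD('m)" by (simp add: \<epsilon>_def)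
    have "norm (x - x\<^sub>0) \<le> CARD('m) * infnorm (x - x\<^sub>0)"
      by (rule cube_norm_le) (auto intro: Basis_le_infnorm)
    also have "\<dots> < r" using i by (simp add: field_simps)
    finally show "x \<in> U" using r by (auto simp: dist_norm norm_minus_commute)
  qed
  moreover have "0 < \<epsilon>" "\<epsilon> \<le> 1" using r by (auto simp: \<epsilon>_def)
  ultimately show ?thesis by (rule that[rotated 2])
qed

section \<open>Uniform comparison on boxes and the lower bound for open sets\<close>

theorem theorem4:
  fixes \<Phi> :: "real^'m \<Rightarrow> complex" and a \<alpha> C c :: real
  assumes "0 < a" and "0 < \<alpha>" and "0 < C"
    and "C1_on \<Phi> {t. norm t < 2}"
  shows
    "(\<exists>K. \<forall>(M :: 'a measure) X Q \<delta> (\<mu> :: real) (M' :: 'b measure) G (A :: real) (\<beta> :: real) (D :: real).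
        balanced_mod_gaussian M X Q \<delta> \<mu> \<Phi> \<and>
        prob_space M' \<and> (\<forall>N\<ge>1. gaussian_vector M' (G N) (Q N)) \<and>
        char_approx M X Q \<delta> \<Phi> a \<alpha> C c \<and>
        1 \<le> A \<and> 0 \<le> \<beta> \<and> exp_growth \<Phi> A \<beta> \<and>
        0 < D \<and>
        D > 2 * (real CARD('m) + 1 +
                 Max {1 / a, A / C, 3 * real CARD('m) * (real CARD('m) + 1) * \<mu> * A}) \<longrightarrow>
        (\<forall>x\<^sub>0 \<epsilon>. 0 < \<epsilon> \<and> \<epsilon> \<le> 1 \<longrightarrow> (\<forall>N\<ge>1.
           \<bar>\<P>(\<omega> in M. X N \<omega> \<in> {x. infnorm (x - x\<^sub>0) < \<epsilon>})
             - \<P>(\<omega> in M'. G N \<omega> \<in> {x. infnorm (x - x\<^sub>0) < \<epsilon>})\<bar>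
           \<le> K * (1 / prod_list (\<delta> N) powr (1 / 2 + 1 / D)
                  + (1 / \<epsilon> ^ CARD('m)) / prod_list (\<delta> N)))))
     \<and>
     (\<forall>U. open U \<and> U \<noteq> {} \<longrightarrow>
       (\<exists>k>0. \<forall>Q \<delta>. \<exists>N\<^sub>0\<ge>1. \<forall>(M :: 'a measure) X (\<mu> :: real) (A :: real) (\<beta> :: real).
          balanced_mod_gaussian M X Q \<delta> \<mu> \<Phi> \<and>
          char_approx M X Q \<delta> \<Phi> a \<alpha> C c \<and>
          1 \<le> A \<and> 0 \<le> \<beta> \<and> exp_growth \<Phi> A \<beta> \<longrightarrow>
          (\<forall>N\<ge>N\<^sub>0. \<P>(\<omega> in M. X N \<omega> \<in> U) \<ge> k * (1 / sqrt (prod_list (\<delta> N))))))"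
proof (cases "\<Phi> 0 = 1 \<and> (\<exists>A \<beta>. 1 \<le> A \<and> 0 \<le> \<beta> \<and> exp_growth \<Phi> A \<beta>)")
  \<comment> \<open>No data satisfy the hypotheses in this case: they force
    \<open>\<Phi> 0 = 1\<close> and supply a growth exponent. Any constants will do.\<close>
  case False
  then have no: "\<not> (balanced_mod_gaussian M X Q \<delta> \<mu> \<Phi> \<and> 1 \<le> A \<and> 0 \<le> \<beta> \<and> exp_growth \<Phi> A \<beta>)"
    for M :: "'a measure" and X Q \<delta> \<mu> A \<beta>
    using mod_gaussian_limit_0 by blast
  show ?thesis
  proof (intro conjI allI impI)
    show "\<exists>k>0. \<forall>Q \<delta>. \<exists>N\<^sub>0\<ge>1. \<forall>(M :: 'a measure) X (\<mu> :: real) (A :: real) (\<beta> :: real).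
          balanced_mod_gaussian M X Q \<delta> \<mu> \<Phi> \<and>
          char_approx M X Q \<delta> \<Phi> a \<alpha> C c \<and>
          1 \<le> A \<and> 0 \<le> \<beta> \<and> exp_growth \<Phi> A \<beta> \<longrightarrow>
          (\<forall>N\<ge>N\<^sub>0. \<P>(\<omega> in M. X N \<omega> \<in> U) \<ge> k * (1 / sqrt (prod_list (\<delta> N))))" for U
      using no by (intro exI[of _ 1]) auto
  qed (use no in blast)
next
  case True
  then have \<Phi>0: "\<Phi> 0 = 1" by blast
  \<comment> \<open>The exponent is extracted from \<open>\<Phi>\<close> alone, so the constants
    below are fixed before \<open>A\<close> and \<open>\<beta>\<close> are given.\<close>
  obtain A' \<beta>' where A': "1 \<le> A'" "0 \<le> \<beta>'" "exp_growth \<Phi> A' \<beta>'"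
    and minimal: "\<And>A \<beta>. 1 \<le> A \<Longrightarrow> 0 \<le> \<beta> \<Longrightarrow> exp_growth \<Phi> A \<beta> \<Longrightarrow> A' \<le> 3 / 2 * A"
    using True near_minimal_growth_exponent by metis
  let ?D = "\<lambda>\<mu> A. 2 * (real CARD('m) + 1 + Max {1 / a, A / C, 3 * real CARD('m) * (real CARD('m) + 1) * \<mu> * A})"
  obtain K where K: "0 \<le> K" and est:
    "\<And>(M :: 'a measure) X Q \<delta> \<mu> A D N x\<^sub>0 \<epsilon>.
      balanced_mod_gaussian M X Q \<delta> \<mu> \<Phi> \<Longrightarrow> char_approx M X Q \<delta> \<Phi> a \<alpha> C c \<Longrightarrow>
      1 \<le> A \<Longrightarrow> A' \<le> 3 / 2 * A \<Longrightarrow> D > ?D \<mu> A \<Longrightarrow> 1 \<le> N \<Longrightarrow> 0 < \<epsilon> \<Longrightarrow> \<epsilon> \<le> 1 \<Longrightarrow>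
      \<bar>\<P>(\<omega> in M. infnorm (X N \<omega> - x\<^sub>0) < \<epsilon>) -
        Re (cube_integral (prod_list (\<delta> N) powr (1 / D) / CARD('m)) \<epsilon> x\<^sub>0 (gauss_char (Q N)))\<bar>
      \<le> box_const TYPE('m) K / (prod_list (\<delta> N) powr (1 / D) * sqrt (prod_list (\<delta> N)))"
    using mod_gaussian_box_estimate[OF assms \<Phi>0 A', where c=c and 'a='a] by blast
  define B where "B = box_const TYPE('m) K"
  have B: "0 \<le> B" "box_const TYPE('m) 0 \<le> B"
    using box_const_mono[OF K, where 'm='m] by (auto simp: B_def)
  have m: "1 \<le> real CARD('m)" by (simp add: Suc_leI)
  have facts: "1 \<le> hd (\<delta> N)" "\<And>d. d \<in> set (\<delta> N) \<Longrightarrow> 0 < d"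
      "prod_list (\<delta> N) \<le> hd (\<delta> N) powr (\<mu> * CARD('m))" "hd (\<delta> N) \<le> prod_list (\<delta> N)"
      "eigenvalue_list (Q N) (\<delta> N)" "\<And>t. 0 \<le> Q N t" "1 \<le> prod_list (\<delta> N)" "0 < \<mu>"
    if bal: "balanced_mod_gaussian M X Q \<delta> \<mu> \<Phi>" and N: "1 \<le> N"
    for M :: "'a measure" and X Q \<delta> \<mu> N
  proof -
    have q: "nonneg_quadratic_form (Q N)" "eigenvalue_list (Q N) (\<delta> N)"
      and \<mu>: "0 < \<mu>" "last (\<delta> N) \<le> hd (\<delta> N) powr \<mu>" and \<sigma>: "1 \<le> prod_list (\<delta> N)"
      using bal N unfolding balanced_mod_gaussian_def balanced_def by blast+
    show "1 \<le> hd (\<delta> N)" "\<And>d. d \<in> set (\<delta> N) \<Longrightarrow> 0 < d"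
      "prod_list (\<delta> N) \<le> hd (\<delta> N) powr (\<mu> * CARD('m))" "hd (\<delta> N) \<le> prod_list (\<delta> N)"
      using balanced_eigenvalues[OF q \<mu> \<sigma>] by blast+
    show "eigenvalue_list (Q N) (\<delta> N)" "1 \<le> prod_list (\<delta> N)" "0 < \<mu>" by fact+
    show "\<And>t. 0 \<le> Q N t" using q(1) by (simp add: nonneg_quadratic_form_def)
  qed
  show ?thesis
  \<comment> \<open>One \<open>B\<close> pays for \<open>X N\<close> and one for \<open>G N\<close>,
    each compared with the same cube integral.\<close>
  proof (rule conjI[OF exI[of _ "2 * B"]]; intro allI impI)
    fix M :: "'a measure" and X Q \<delta> \<mu> and M' :: "'b measure" and G and A \<beta> D \<epsilon> :: real and x\<^sub>0 and N :: nat
    assume h: "balanced_mod_gaussian M X Q \<delta> \<mu> \<Phi> \<and>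
        prob_space M' \<and> (\<forall>N\<ge>1. gaussian_vector M' (G N) (Q N)) \<and>
        char_approx M X Q \<delta> \<Phi> a \<alpha> C c \<and>
        1 \<le> A \<and> 0 \<le> \<beta> \<and> exp_growth \<Phi> A \<beta> \<and> 0 < D \<and> D > ?D \<mu> A"
      and \<epsilon>: "0 < \<epsilon> \<and> \<epsilon> \<le> 1" and N: "1 \<le> N"
    have bal: "balanced_mod_gaussian M X Q \<delta> \<mu> \<Phi>" and ca: "char_approx M X Q \<delta> \<Phi> a \<alpha> C c"
      and G: "prob_space M'" "gaussian_vector M' (G N) (Q N)" and A: "1 \<le> A" "A' \<le> 3 / 2 * A"
      and D: "D > ?D \<mu> A"
      using h N minimal by blast+
    note f = facts[OF bal N]
    define \<sigma> where "\<sigma> = prod_list (\<delta> N)"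
    have \<sigma>: "1 \<le> \<sigma>" using f(7) by (simp add: \<sigma>_def)
    define S where "S = \<sigma> powr (1 / D)"
    have S: "1 \<le> S"
      unfolding S_def \<sigma>_def by (rule scale_bounds(2)[OF f(7,1,3) m f(8) A assms(1,3) D])
    have "\<bar>\<P>(\<omega> in M. infnorm (X N \<omega> - x\<^sub>0) < \<epsilon>) - Re (cube_integral (S / CARD('m)) \<epsilon> x\<^sub>0 (gauss_char (Q N)))\<bar>
        \<le> B / (S * sqrt \<sigma>)"
      using est[OF bal ca A D N] \<epsilon> by (simp add: S_def \<sigma>_def B_def)
    moreover have "\<bar>\<P>(\<omega> in M'. infnorm (G N \<omega> - x\<^sub>0) < \<epsilon>) - Re (cube_integral (S / CARD('m)) \<epsilon> x\<^sub>0 (gauss_char (Q N)))\<bar>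
        \<le> B / (S * sqrt \<sigma>)"
    proof -
      have "box_const TYPE('m) 0 / (S * sqrt \<sigma>) \<le> B / (S * sqrt \<sigma>)"
        using B(2) S \<sigma> by (intro divide_right_mono) auto
      then show ?thesis
        using gaussian_vector_box_estimate[OF G f(5,2,6) S, of \<epsilon> x\<^sub>0] \<epsilon> unfolding \<sigma>_def by linarith
    qed
    ultimately have "\<bar>\<P>(\<omega> in M. infnorm (X N \<omega> - x\<^sub>0) < \<epsilon>) - \<P>(\<omega> in M'. infnorm (G N \<omega> - x\<^sub>0) < \<epsilon>)\<bar>
        \<le> 2 * (B / (S * sqrt \<sigma>))" by linarith
    also have "S * sqrt \<sigma> = \<sigma> powr (1 / 2 + 1 / D)"
      using \<sigma> by (simp add: S_def powr_add powr_half_sqrt mult.commute)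
    also have "2 * (B / \<sigma> powr (1 / 2 + 1 / D)) \<le> 2 * B * (1 / \<sigma> powr (1 / 2 + 1 / D) + 1 / \<epsilon> ^ CARD('m) / \<sigma>)"
      using B(1) \<sigma> \<epsilon> by (simp add: distrib_left)
    finally show "\<bar>\<P>(\<omega> in M. X N \<omega> \<in> {x. infnorm (x - x\<^sub>0) < \<epsilon>})
             - \<P>(\<omega> in M'. G N \<omega> \<in> {x. infnorm (x - x\<^sub>0) < \<epsilon>})\<bar>
           \<le> 2 * B * (1 / prod_list (\<delta> N) powr (1 / 2 + 1 / D)
                  + (1 / \<epsilon> ^ CARD('m)) / prod_list (\<delta> N))"
      by (simp add: \<sigma>_def)
  next
    fix U :: "(real^'m) set" assume "open U \<and> U \<noteq> {}"
    then obtain x\<^sub>0 :: "real^'m" and \<epsilon> :: real where \<epsilon>: "0 < \<epsilon>" "\<epsilon> \<le> 1" and box: "{x. infnorm (x - x\<^sub>0) < \<epsilon>} \<subseteq> U" and U: "open U"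
      using open_contains_infnorm_box by metis
    \<comment> \<open>\<open>k\<close> and \<open>L\<close> are the coefficients of the main term
      and of the error in the lower bound for the cube integral.\<close>
    define k where "k = (\<epsilon> / pi) ^ CARD('m) * sqrt (2 * pi) ^ CARD('m)"
    have k: "0 < k" using \<epsilon> by (simp add: k_def)
    define L where "L = (real CARD('m) * (2 * real CARD('m) + 1) + norm x\<^sub>0) * sqrt (4 * pi) ^ CARD('m)"
    show "\<exists>k>0. \<forall>Q \<delta>. \<exists>N\<^sub>0\<ge>1. \<forall>(M :: 'a measure) X (\<mu> :: real) (A :: real) (\<beta> :: real).
          balanced_mod_gaussian M X Q \<delta> \<mu> \<Phi> \<and>
          char_approx M X Q \<delta> \<Phi> a \<alpha> C c \<and>
          1 \<le> A \<and> 0 \<le> \<beta> \<and> exp_growth \<Phi> A \<beta> \<longrightarrow>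
          (\<forall>N\<ge>N\<^sub>0. \<P>(\<omega> in M. X N \<omega> \<in> U) \<ge> k * (1 / sqrt (prod_list (\<delta> N))))"
    proof (intro exI[of _ "k / 2"] conjI allI)
      show "0 < k / 2" using k by simp
      fix Q \<delta>
      show "\<exists>N\<^sub>0\<ge>1. \<forall>(M :: 'a measure) X (\<mu> :: real) (A :: real) (\<beta> :: real).
          balanced_mod_gaussian M X Q \<delta> \<mu> \<Phi> \<and>
          char_approx M X Q \<delta> \<Phi> a \<alpha> C c \<and>
          1 \<le> A \<and> 0 \<le> \<beta> \<and> exp_growth \<Phi> A \<beta> \<longrightarrow>
          (\<forall>N\<ge>N\<^sub>0. \<P>(\<omega> in M. X N \<omega> \<in> U) \<ge> k / 2 * (1 / sqrt (prod_list (\<delta> N))))"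
      proof (cases "\<exists>(M :: 'a measure) X \<mu>. balanced_mod_gaussian M X Q \<delta> \<mu> \<Phi>")
        case False
        then show ?thesis by blast
      next
        case True
        \<comment> \<open>The threshold may depend on \<open>Q\<close> and \<open>\<delta>\<close>
          but must precede \<open>M\<close>, \<open>X\<close> and the balance exponent, so it is
          computed with the \<open>\<mu>\<close> of one sample model.\<close>
        then obtain M0 :: "'a measure" and X0 \<mu> where bal0: "balanced_mod_gaussian M0 X0 Q \<delta> \<mu> \<Phi>" by blast
        note f = facts[OF bal0]
        have bal\<mu>: "balanced \<mu> \<delta>" "0 < \<mu>" using bal0 by (auto simp: balanced_mod_gaussian_def)
        \<comment> \<open>This statement has no \<open>D\<close> of its own; one just above the
          threshold for \<open>\<mu>\<close> and \<open>A'\<close> is chosen.\<close>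
        define D where "D = ?D \<mu> A' + 1"
        have D: "D > ?D \<mu> A'" by (simp add: D_def)
        have A'2: "A' \<le> 3 / 2 * A'" using A' by simp
        have D0: "0 < D"
          by (rule scale_bounds(1)[OF f(7,1,3)[OF order_refl] m bal\<mu>(2) A'(1) A'2 assms(1,3) D])
        have hd_top: "filterlim (\<lambda>N. hd (\<delta> N)) at_top sequentially"
          by (rule balanced_hd_at_top[OF bal\<mu> f(1)])
        \<comment> \<open>Relative to \<open>1 / sqrt \<sigma>\<close>, these are the errors of the
          cube integral and of the box estimate. Once their sum is below \<open>k / 2\<close>, half
          of the main term survives.\<close>
        have "((\<lambda>d. L / sqrt d + B / d powr (1 / D)) \<longlongrightarrow> 0 + 0) at_top"
          using D0 by (intro tendsto_add tendsto_divide_0[OF tendsto_const]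
            filterlim_at_top_imp_at_infinity sqrt_at_top powr_at_top) auto
        then have "((\<lambda>N. L / sqrt (hd (\<delta> N)) + B / hd (\<delta> N) powr (1 / D)) \<longlonglongrightarrow> 0)"
          using filterlim_compose[OF _ hd_top] by auto
        then have "\<forall>\<^sub>F N in sequentially. L / sqrt (hd (\<delta> N)) + B / hd (\<delta> N) powr (1 / D) < k / 2"
          using k by (intro order_tendstoD) auto
        then obtain N\<^sub>0 where N\<^sub>0: "\<And>N. N\<^sub>0 \<le> N \<Longrightarrow> L / sqrt (hd (\<delta> N)) + B / hd (\<delta> N) powr (1 / D) < k / 2"
          by (auto simp: eventually_sequentially)
        show ?thesis
        proof (intro exI[of _ "max 1 N\<^sub>0"] conjI allI impI)
          fix M :: "'a measure" and X and \<mu>' A \<beta> :: real and N :: nat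
          assume h: "balanced_mod_gaussian M X Q \<delta> \<mu>' \<Phi> \<and> char_approx M X Q \<delta> \<Phi> a \<alpha> C c \<and>
            1 \<le> A \<and> 0 \<le> \<beta> \<and> exp_growth \<Phi> A \<beta>" and "max 1 N\<^sub>0 \<le> N"
          then have N: "1 \<le> N" "N\<^sub>0 \<le> N" by auto
          \<comment> \<open>Balance is a property of \<open>\<delta>\<close> alone, so the
            \<open>\<mu>\<close> of the sample model may replace \<open>\<mu>'\<close>.\<close>
          have bal: "balanced_mod_gaussian M X Q \<delta> \<mu> \<Phi>"
            using h bal\<mu> by (auto simp: balanced_mod_gaussian_def)
          interpret prob_space M using bal by (simp add: balanced_mod_gaussian_def)
          have [measurable]: "X N \<in> borel_measurable M"
            using bal N by (auto simp: balanced_mod_gaussian_def)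
          note f = f[OF N(1)]
          define \<sigma> where "\<sigma> = prod_list (\<delta> N)"
          have \<sigma>: "1 \<le> \<sigma>" "hd (\<delta> N) \<le> \<sigma>" using f(4,7) by (auto simp: \<sigma>_def)
          define S where "S = \<sigma> powr (1 / D)"
          have S: "1 \<le> S"
            unfolding S_def \<sigma>_def by (rule scale_bounds(2)[OF f(7,1,3) m f(8) A'(1) A'2 assms(1,3) D])
          have "B / S \<le> B / hd (\<delta> N) powr (1 / D)"
            unfolding S_def using B(1) \<sigma> f(1) D0 by (intro divide_left_mono powr_mono2) auto
          then have small: "L / sqrt (hd (\<delta> N)) + B / S < k / 2" using N\<^sub>0[OF N(2)] by linarith
          have up: "\<bar>\<P>(\<omega> in M. infnorm (X N \<omega> - x\<^sub>0) < \<epsilon>) - Re (cube_integral (S / CARD('m)) \<epsilon> x\<^sub>0 (gauss_char (Q N)))\<bar>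
              \<le> B / (S * sqrt \<sigma>)"
            using est[OF bal _ A'(1) A'2 D N(1) \<epsilon>] h by (simp add: S_def \<sigma>_def B_def)
          have low: "(k - L / sqrt (hd (\<delta> N))) / sqrt \<sigma> \<le> Re (cube_integral (S / CARD('m)) \<epsilon> x\<^sub>0 (gauss_char (Q N)))"
            using cube_integral_lower_bound[OF f(5,2,1) S \<epsilon>] by (simp add: k_def L_def \<sigma>_def)
          have "k / 2 * (1 / sqrt \<sigma>) = (k / 2) / sqrt \<sigma>" by simp
          also have "\<dots> \<le> (k - L / sqrt (hd (\<delta> N)) - B / S) / sqrt \<sigma>"
            using small \<sigma> by (intro divide_right_mono) auto
          also have "\<dots> = (k - L / sqrt (hd (\<delta> N))) / sqrt \<sigma> - B / (S * sqrt \<sigma>)"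
            by (simp add: diff_divide_distrib)
          also have "\<dots> \<le> \<P>(\<omega> in M. infnorm (X N \<omega> - x\<^sub>0) < \<epsilon>)" using up low by linarith
          also have "\<dots> \<le> \<P>(\<omega> in M. X N \<omega> \<in> U)"
          proof (rule finite_measure_mono)
            show "{\<omega> \<in> space M. X N \<omega> \<in> U} \<in> sets M"
            proof -
              have "X N -` U \<inter> space M \<in> sets M"
                by (rule measurable_sets[of _ _ borel]) (use U in auto)
              also have "X N -` U \<inter> space M = {\<omega> \<in> space M. X N \<omega> \<in> U}" by auto
              finally show ?thesis .
            qed
            show "{\<omega> \<in> space M. infnorm (X N \<omega> - x\<^sub>0) < \<epsilon>} \<subseteq> {\<omega> \<in> space M. X N \<omega> \<in> U}"
              using box by blast
          qed
          finally show "k / 2 * (1 / sqrt (prod_list (\<delta> N))) \<le> \<P>(\<omega> in M. X N \<omega> \<in> U)"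
            by (simp add: \<sigma>_def)
        qed simp
      qed
    qed
  qed
qed

end
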